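(* Let $M$ be a complete, connected, $n$-dimensional Riemannian manifold and let $F=(f_1,\dots,f_m):M\to\mathbb{R}^m$ be continuously differentiable. Let $\{p^k\}_{k\ge 0}$ be an infinite sequence generated by the steepest descent method with Armijo rule (described in the context; in particular no $p^k$ is Pareto critical), for some $\beta\in(0,1)$ and some starting point $p^0\in M$. Then: (i) $\{F(p^k)\}$ is decreasing, i.e. $F(p^{k+1})\prec F(p^k)$ for all $k\ge 0$; (ii) each accumulation point of the sequence $\{p^k\}$ is a Pareto critical point of $F$.
   Context: Notation: $I=\{1,\dots,m\}$; for $x,y\in\mathbb{R}^m$, $x\preceq y$ means $y_i-x_i\ge 0$ for all $i\in I$, and $x\prec y$ means $y_i-x_i>0$ for all $i\in I$; $\mathbb{R}^m_{++}=\{x\in\mathbb{R}^m: x_i>0,\ i\in I\}$. $\langle\cdot,\cdot\rangle$ and $\|\cdot\|$ denote the Riemannian metric and its norm, $\operatorname{grad} f_i$ the Riemannian gradient, $\exp_p:T_pM\to M$ the exponential map. For $p\in M$, $v\in T_pM$, $\operatorname{grad}F(p)v:=(\langle\operatorname{grad}f_1(p),v\rangle,\dots,\langle\operatorname{grad}f_m(p),v\rangle)\in\mathbb{R}^m$. A point $p\in M$ is Pareto critical for $F$ if $\{\operatorname{grad}F(p)v: v\in T_pM\}\cap(-\mathbb{R}^m_{++})=\emptyset$. The steepest descent direction of $F$ at $p$ is the unique minimizer $$v(p):=\operatorname{argmin}_{v\in T_pM}\left\{\max_{i\in I}\langle\operatorname{grad}f_i(p),v\rangle+\tfrac12\|v\|^2\right\}\in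 T_pM.$$ Steepest descent method with Armijo rule: take $\beta\in(0,1)$ and $p^0\in M$. Given $p^k$: if $p^k$ is Pareto critical, stop. Otherwise set $v^k:=v(p^k)$, $$t_k:=\max\left\{2^{-j}: j\in\{0,1,2,\dots\},\ F(\exp_{p^k}(2^{-j}v^k))\preceq F(p^k)+\beta 2^{-j}\operatorname{grad}F(p^k)v^k\right\},$$ and $p^{k+1}:=\exp_{p^k}(t_kv^k)$. *)

theory Defs
  imports "HOL-Analysis.Analysis" "HOL-Library.Function_Algebras"
begin

text \<open>Meant for open \<open>S\<close>; all directional derivatives of order up to \<open>k\<close> exist and are continuous.\<close>

primrec Ck_on :: "nat \<Rightarrow> 'a::euclidean_space set \<Rightarrow> ('a \<Rightarrow> 'b::real_normed_vector) \<Rightarrow> bool" where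
  "Ck_on 0 S f \<longleftrightarrow> continuous_on S f"
| "Ck_on (Suc k) S f \<longleftrightarrow> (\<forall>x\<in>S. f differentiable (at x)) \<and>
     (\<forall>v. Ck_on k S (\<lambda>x. frechet_derivative f (at x) v))"

definition smooth_on :: "'a::euclidean_space set \<Rightarrow> ('a \<Rightarrow> 'b::real_normed_vector) \<Rightarrow> bool" where
  "smooth_on S f \<longleftrightarrow> (\<forall>k. Ck_on k S f)"

text \<open>The manifold is the whole (Hausdorff, second countable) space \<open>'a\<close>; its dimension is
  \<open>DIM('e)\<close>. A chart \<open>(U, \<phi>)\<close> is a homeomorphism \<open>\<phi>\<close> of the open set \<open>U\<close> onto an open subset of \<open>'e\<close>;
  the values of \<open>\<phi>\<close> outside \<open>U\<close> are irrelevant.\<close>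

type_synonym ('a, 'e) chart = "'a set \<times> ('a \<Rightarrow> 'e)"

abbreviation chart_dom :: "('a, 'e) chart \<Rightarrow> 'a set" where
  "chart_dom c \<equiv> fst c"

abbreviation chart_map :: "('a, 'e) chart \<Rightarrow> 'a \<Rightarrow> 'e" where
  "chart_map c \<equiv> snd c"

definition chart_inv :: "('a, 'e) chart \<Rightarrow> 'e \<Rightarrow> 'a" where
  "chart_inv c = inv_into (chart_dom c) (chart_map c)"

definition transition :: "('a, 'e) chart \<Rightarrow> ('a, 'e) chart \<Rightarrow> 'e \<Rightarrow> 'e" where
  "transition c c' = chart_map c' \<circ> chart_inv c"

definition smooth_atlas ::
    "('a::{t2_space, second_countable_topology}, 'e::euclidean_space) chart set \<Rightarrow> bool" where
  "smooth_atlas A \<longleftrightarrow>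
     (\<Union>c\<in>A. chart_dom c) = UNIV \<and>
     (\<forall>c\<in>A. open (chart_dom c) \<and> open (chart_map c ` chart_dom c) \<and>
        homeomorphism (chart_dom c) (chart_map c ` chart_dom c) (chart_map c) (chart_inv c)) \<and>
     (\<forall>c\<in>A. \<forall>c'\<in>A. smooth_on (chart_map c ` (chart_dom c \<inter> chart_dom c')) (transition c c'))"

definition continuously_differentiable ::
    "('a, 'e::euclidean_space) chart set \<Rightarrow> ('a \<Rightarrow> 'b::real_normed_vector) \<Rightarrow> bool" where
  "continuously_differentiable A f \<longleftrightarrow>
     (\<forall>c\<in>A. Ck_on 1 (chart_map c ` chart_dom c) (f \<circ> chart_inv c))"

instantiation "fun" :: (type, real_vector) real_vector
begin

definition scaleR_fun :: "real \<Rightarrow> ('a \<Rightarrow> 'b) \<Rightarrow> 'a \<Rightarrow> 'b" where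
  "scaleR_fun r f = (\<lambda>x. r *\<^sub>R f x)"

instance
  by standard (auto simp: scaleR_fun_def fun_eq_iff scaleR_add_right scaleR_add_left)

end

text \<open>A tangent vector at \<open>p\<close> is the family of its coordinate vectors in all the charts of the atlas
  around \<open>p\<close>, which are related by the derivatives of the transition maps. The entries at all other
  pairs \<open>(U, \<phi>)\<close> carry no information and are set to \<open>0\<close>.\<close>

type_synonym ('a, 'e) tangent_vector = "('a, 'e) chart \<Rightarrow> 'e"

definition tangent_space ::
    "('a, 'e::euclidean_space) chart set \<Rightarrow> 'a \<Rightarrow> ('a, 'e) tangent_vector set" where
  "tangent_space A p = {v.
     (\<forall>c\<in>A. \<forall>c'\<in>A. p \<in> chart_dom c \<inter> chart_dom c' \<longrightarrow>
        v c' = frechet_derivative (transition c c') (at (chart_map c p)) (v c)) \<and>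
     (\<forall>c. c \<notin> A \<or> p \<notin> chart_dom c \<longrightarrow> v c = 0)}"

text \<open>The tangent vector at \<open>p\<close> whose coordinate vector in the chart \<open>c\<close> is \<open>u\<close>.\<close>

definition coord_vector ::
    "('a, 'e::euclidean_space) chart set \<Rightarrow> ('a, 'e) chart \<Rightarrow> 'a \<Rightarrow> 'e \<Rightarrow> ('a, 'e) tangent_vector" where
  "coord_vector A c p u = (\<lambda>c'.
     if c' \<in> A \<and> p \<in> chart_dom c'
     then frechet_derivative (transition c c') (at (chart_map c p)) u else 0)"

definition velocity ::
    "('a, 'e::euclidean_space) chart set \<Rightarrow> (real \<Rightarrow> 'a) \<Rightarrow> real \<Rightarrow> ('a, 'e) tangent_vector" where
  "velocity A \<gamma> t = (\<lambda>c.
     if c \<in> A \<and> \<gamma> t \<in> chart_dom c then vector_derivative (chart_map c \<circ> \<gamma>) (at t) else 0)"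

type_synonym ('a, 'e) metric =
  "'a \<Rightarrow> ('a, 'e) tangent_vector \<Rightarrow> ('a, 'e) tangent_vector \<Rightarrow> real"

text \<open>\<open>metric_in A g c x\<close> is the bilinear form on \<open>'e\<close> representing the metric in the chart \<open>c\<close>
  at the point with coordinates \<open>x\<close>.\<close>

definition metric_in ::
    "('a, 'e::euclidean_space) chart set \<Rightarrow> ('a, 'e) metric \<Rightarrow> ('a, 'e) chart \<Rightarrow> 'e \<Rightarrow> 'e \<Rightarrow> 'e \<Rightarrow> real"
  where
  "metric_in A g c x u w =
     g (chart_inv c x) (coord_vector A c (chart_inv c x) u) (coord_vector A c (chart_inv c x) w)"

definition riemannian_metric ::
    "('a, 'e::euclidean_space) chart set \<Rightarrow> ('a, 'e) metric \<Rightarrow> bool" where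
  "riemannian_metric A g \<longleftrightarrow>
     (\<forall>p. \<forall>u\<in>tangent_space A p. \<forall>v\<in>tangent_space A p. g p u v = g p v u) \<and>
     (\<forall>p. \<forall>u\<in>tangent_space A p. \<forall>v\<in>tangent_space A p. \<forall>w\<in>tangent_space A p.
        g p (u + v) w = g p u w + g p v w) \<and>
     (\<forall>p. \<forall>a. \<forall>u\<in>tangent_space A p. \<forall>v\<in>tangent_space A p. g p (a *\<^sub>R u) v = a * g p u v) \<and>
     (\<forall>p. \<forall>u\<in>tangent_space A p. u \<noteq> 0 \<longrightarrow> g p u u > 0) \<and>
     (\<forall>c\<in>A. \<forall>u w. smooth_on (chart_map c ` chart_dom c) (\<lambda>x. metric_in A g c x u w))"

definition riemannian_norm :: "('a, 'e) metric \<Rightarrow> 'a \<Rightarrow> ('a, 'e) tangent_vector \<Rightarrow> real" where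
  "riemannian_norm g p v = sqrt (g p v v)"

text \<open>The vector \<open>\<Sum>\<^sub>k \<Gamma>\<^sup>k\<^sub>i\<^sub>j u\<^sup>i w\<^sup>j e\<^sub>k\<close> formed with the Christoffel symbols of the Levi-Civita
  connection in the chart \<open>c\<close>; the defining equation is Koszul's formula for vector fields with
  constant coordinates.\<close>

definition christoffel ::
    "('a, 'e::euclidean_space) chart set \<Rightarrow> ('a, 'e) metric \<Rightarrow> ('a, 'e) chart \<Rightarrow> 'e \<Rightarrow> 'e \<Rightarrow> 'e \<Rightarrow> 'e"
  where
  "christoffel A g c x u w = (THE y. \<forall>z. metric_in A g c x y z =
     (frechet_derivative (\<lambda>x. metric_in A g c x w z) (at x) u
      + frechet_derivative (\<lambda>x. metric_in A g c x u z) (at x) w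
      - frechet_derivative (\<lambda>x. metric_in A g c x u w) (at x) z) / 2)"

text \<open>In every chart, \<open>x'' + \<Gamma>(x', x') = 0\<close>.\<close>

definition geodesic ::
    "('a::topological_space, 'e::euclidean_space) chart set \<Rightarrow> ('a, 'e) metric \<Rightarrow> (real \<Rightarrow> 'a) \<Rightarrow> bool"
  where
  "geodesic A g \<gamma> \<longleftrightarrow> continuous_on UNIV \<gamma> \<and>
     (\<forall>c\<in>A. \<forall>t. \<gamma> t \<in> chart_dom c \<longrightarrow>
        (let x = chart_map c \<circ> \<gamma>; x' = (\<lambda>s. vector_derivative x (at s)) in
          x differentiable (at t) \<and>
          (x' has_vector_derivative - christoffel A g c (x t) (x' t) (x' t)) (at t)))"

definition geodesically_complete ::
    "('a::topological_space, 'e::euclidean_space) chart set \<Rightarrow> ('a, 'e) metric \<Rightarrow> bool" where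
  "geodesically_complete A g \<longleftrightarrow>
     (\<forall>p. \<forall>v\<in>tangent_space A p. \<exists>\<gamma>. geodesic A g \<gamma> \<and> \<gamma> 0 = p \<and> velocity A \<gamma> 0 = v)"

definition riemannian_exp ::
    "('a::topological_space, 'e::euclidean_space) chart set \<Rightarrow> ('a, 'e) metric \<Rightarrow>
     'a \<Rightarrow> ('a, 'e) tangent_vector \<Rightarrow> 'a" where
  "riemannian_exp A g p v =
     (THE q. \<exists>\<gamma>. geodesic A g \<gamma> \<and> \<gamma> 0 = p \<and> velocity A \<gamma> 0 = v \<and> \<gamma> 1 = q)"

text \<open>The gradient represents the differential, \<open>\<langle>grad f(p), v\<rangle> = df\<^sub>p(v)\<close>; the differential is
  computed in an arbitrary chart around \<open>p\<close>.\<close>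

definition riemannian_grad ::
    "('a, 'e::euclidean_space) chart set \<Rightarrow> ('a, 'e) metric \<Rightarrow> ('a \<Rightarrow> real) \<Rightarrow> 'a \<Rightarrow>
     ('a, 'e) tangent_vector" where
  "riemannian_grad A g f p = (THE u. u \<in> tangent_space A p \<and>
     (\<forall>v\<in>tangent_space A p. \<forall>c\<in>A. p \<in> chart_dom c \<longrightarrow>
        g p u v = frechet_derivative (f \<circ> chart_inv c) (at (chart_map c p)) (v c)))"

text \<open>The components of \<open>F\<close> are indexed by the finite type \<open>'m\<close>.\<close>

definition grad_apply ::
    "('a, 'e::euclidean_space) chart set \<Rightarrow> ('a, 'e) metric \<Rightarrow> ('a \<Rightarrow> real^'m) \<Rightarrow> 'a \<Rightarrow>
     ('a, 'e) tangent_vector \<Rightarrow> real^'m" where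
  "grad_apply A g F p v = (\<chi> i. g p (riemannian_grad A g (\<lambda>q. F q $ i) p) v)"

definition pareto_critical ::
    "('a, 'e::euclidean_space) chart set \<Rightarrow> ('a, 'e) metric \<Rightarrow> ('a \<Rightarrow> real^'m) \<Rightarrow> 'a \<Rightarrow> bool" where
  "pareto_critical A g F p \<longleftrightarrow>
     grad_apply A g F p ` tangent_space A p \<inter> uminus ` {x. \<forall>i. x $ i > 0} = {}"

definition steepest_descent_direction ::
    "('a, 'e::euclidean_space) chart set \<Rightarrow> ('a, 'e) metric \<Rightarrow> ('a \<Rightarrow> real^'m) \<Rightarrow> 'a \<Rightarrow>
     ('a, 'e) tangent_vector" where
  "steepest_descent_direction A g F p = (THE v. is_arg_min
     (\<lambda>v. (MAX i. grad_apply A g F p v $ i) + (riemannian_norm g p v)\<^sup>2 / 2)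
     (\<lambda>v. v \<in> tangent_space A p) v)"

text \<open>The order \<open>\<le>\<close> on \<open>real^'m\<close> is the componentwise one.\<close>

definition armijo_step ::
    "('a::topological_space, 'e::euclidean_space) chart set \<Rightarrow> ('a, 'e) metric \<Rightarrow>
     ('a \<Rightarrow> real^'m) \<Rightarrow> real \<Rightarrow> 'a \<Rightarrow> ('a, 'e) tangent_vector \<Rightarrow> real" where
  "armijo_step A g F \<beta> p v = (GREATEST t. \<exists>j::nat. t = (1/2)^j \<and>
     F (riemannian_exp A g p (t *\<^sub>R v)) \<le> F p + (\<beta> * t) *\<^sub>R grad_apply A g F p v)"

definition steepest_descent_sequence ::
    "('a::topological_space, 'e::euclidean_space) chart set \<Rightarrow> ('a, 'e) metric \<Rightarrow>
     ('a \<Rightarrow> real^'m) \<Rightarrow> real \<Rightarrow> (nat \<Rightarrow> 'a) \<Rightarrow> bool" where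
  "steepest_descent_sequence A g F \<beta> p \<longleftrightarrow>
     (\<forall>k. \<not> pareto_critical A g F (p k) \<and>
        (let v = steepest_descent_direction A g F (p k); t = armijo_step A g F \<beta> (p k) v
         in p (Suc k) = riemannian_exp A g (p k) (t *\<^sub>R v)))"

definition accumulation_point :: "(nat \<Rightarrow> 'a::topological_space) \<Rightarrow> 'a \<Rightarrow> bool" where
  "accumulation_point p q \<longleftrightarrow> (\<exists>r::nat \<Rightarrow> nat. strict_mono r \<and> (p \<circ> r) \<longlonglongrightarrow> q)"

end

theory Submission
  imports Defs
begin

text \<open>Everything rests on one local estimate (\<open>armijo_uniform\<close>): every point \<open>q\<close> that is not Pareto critical has
a neighbourhood \<open>U\<close>, a number \<open>\<eta> > 0\<close> and an exponent \<open>j\<close> such that at each \<open>p \<in> U\<close> all components of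
\<open>grad F(p) v(p)\<close> are at most \<open>- \<eta>\<close> and the step \<open>2\<^sup>-\<^sup>j\<close> passes the Armijo test. Hence the step length chosen
at an iterate in \<open>U\<close> is at least \<open>2\<^sup>-\<^sup>j\<close>, and the step decreases every component of \<open>F\<close> by at least the
fixed amount \<open>\<beta> 2\<^sup>-\<^sup>j \<eta>\<close>. With \<open>q = p k\<close> this is the strict decrease of \<open>F\<close>. If a subsequence converged to a
noncritical \<open>q\<close>, its members would eventually lie in \<open>U\<close>; by monotonicity the values of each component along
the subsequence would drop by a fixed amount at every index, although they converge to the value at \<open>q\<close>.

The estimate is obtained in a chart around \<open>q\<close>. The optimal value of the problem defining \<open>v(p)\<close> is negative
at \<open>q\<close>, and comparison with one fixed coordinate vector shows that it stays below \<open>- \<eta>\<close> nearby; this bounds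
\<open>grad F(p) v(p)\<close> from above and the length of \<open>v(p)\<close> as well. The Christoffel symbols are bounded near \<open>q\<close>, so
all geodesics issuing from points near \<open>q\<close> with such initial velocities remain in the chart, with almost
constant velocity, up to a common time (\<open>geodesic_stays_near\<close>). By the mean value theorem and the continuity of
the derivative of \<open>F\<close>, the slope of \<open>F\<close> along them exceeds its initial value by at most \<open>(1 - \<beta>) \<eta>\<close>;
the Armijo inequality leaves at least this much room, since the initial slope is at most \<open>- \<eta>\<close>.

The exponential map, the gradient and the steepest descent direction are definite descriptions, so each needs
an existence and uniqueness proof. For the exponential map this is the uniqueness of geodesics
(\<open>geodesic_unique\<close>), which comes from a local Lipschitz bound on the geodesic equation and a Gronwall
argument; for the gradient it is the Riesz representation, and for the direction strict convexity.\<close>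

section \<open>Multilinear forms and continuously differentiable functions\<close>


lemma abs_linear_le_of_basis:
  fixes h :: "'e::euclidean_space \<Rightarrow> real"
  assumes "linear h" and "\<And>b. b \<in> Basis \<Longrightarrow> \<bar>h b\<bar> \<le> C"
  shows "\<bar>h u\<bar> \<le> C * DIM('e) * norm u"
proof -
  have "h u = (\<Sum>b\<in>Basis. (u \<bullet> b) * h b)"
    using linear_sum[OF assms(1), of "\<lambda>b. (u \<bullet> b) *\<^sub>R b" Basis] linear_scale[OF assms(1)]
    by (simp add: euclidean_representation)
  also have "\<bar>\<dots>\<bar> \<le> (\<Sum>b\<in>(Basis::'e set). norm u * C)"
    unfolding abs_mult
    by (intro order_trans[OF sum_abs] sum_mono)
      (auto simp: abs_mult intro!: mult_mono assms(2) Basis_le_norm)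
  finally show ?thesis by (simp add: mult_ac)
qed

lemma abs_bilinear_le_of_basis:
  fixes B :: "'e::euclidean_space \<Rightarrow> 'e \<Rightarrow> real"
  assumes "\<And>w. linear (\<lambda>u. B u w)" and "\<And>u. linear (B u)"
    and "\<And>b b'. b \<in> Basis \<Longrightarrow> b' \<in> Basis \<Longrightarrow> \<bar>B b b'\<bar> \<le> C"
  shows "\<bar>B u w\<bar> \<le> C * DIM('e) ^ 2 * norm u * norm w"
proof -
  have "\<bar>B u b\<bar> \<le> C * DIM('e) * norm u" if "b \<in> Basis" for b
    using abs_linear_le_of_basis[OF assms(1)] assms(3) that by blast
  from abs_linear_le_of_basis[OF assms(2) this, of w] show ?thesis
    by (simp add: power2_eq_square mult_ac)
qed

lemma abs_trilinear_le_of_basis: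
  fixes D :: "'e::euclidean_space \<Rightarrow> 'e \<Rightarrow> 'e \<Rightarrow> real"
  assumes "\<And>v w. linear (\<lambda>u. D u v w)" and "\<And>u w. linear (\<lambda>v. D u v w)" and "\<And>u v. linear (D u v)"
    and "\<And>b b' b''. b \<in> Basis \<Longrightarrow> b' \<in> Basis \<Longrightarrow> b'' \<in> Basis \<Longrightarrow> \<bar>D b b' b''\<bar> \<le> C"
  shows "\<bar>D u v w\<bar> \<le> C * DIM('e) ^ 3 * norm u * norm v * norm w"
proof -
  have "\<bar>D u v b\<bar> \<le> C * DIM('e) ^ 2 * norm u * norm v" if "b \<in> Basis" for b
    by (rule abs_bilinear_le_of_basis[OF assms(1,2)]) (use assms(4) that in blast)
  from abs_linear_le_of_basis[OF assms(3) this, of w] show ?thesis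
    by (simp add: power2_eq_square power3_eq_cube mult_ac)
qed

lemma Ck_on_1D:
  assumes "Ck_on 1 S f"
  shows "x \<in> S \<Longrightarrow> f differentiable (at x)"
    and "continuous_on S (\<lambda>x. frechet_derivative f (at x) v)"
  using assms by (auto simp: One_nat_def)

lemma Ck_on_1_imp_continuous_on: "Ck_on 1 S f \<Longrightarrow> continuous_on S f"
  by (meson Ck_on_1D(1) continuous_at_imp_continuous_on differentiable_imp_continuous_within)

lemma Ck_on_2D:
  assumes "Ck_on 2 S f"
  shows "x \<in> S \<Longrightarrow> f differentiable (at x)"
    and "Ck_on 1 S (\<lambda>x. frechet_derivative f (at x) v)" and "Ck_on 1 S f"
proof -
  show 1: "x \<in> S \<Longrightarrow> f differentiable (at x)"
    and 2: "Ck_on 1 S (\<lambda>x. frechet_derivative f (at x) v)" for x v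
    using assms by (auto simp: numeral_2_eq_2)
  show "Ck_on 1 S f"
    using 1 2[THEN Ck_on_1_imp_continuous_on] by simp
qed

text \<open>The partial derivatives are bounded on the compact ball, and the ball is convex.\<close>

lemma Ck_on_1_lipschitz:
  fixes f :: "'e::euclidean_space \<Rightarrow> real"
  assumes f: "Ck_on 1 S f" and sub: "cball x0 r \<subseteq> S"
  obtains B where "0 \<le> B" "\<And>x y. x \<in> cball x0 r \<Longrightarrow> y \<in> cball x0 r \<Longrightarrow> \<bar>f x - f y\<bar> \<le> B * norm (x - y)"
proof -
  have "\<exists>B. \<forall>x\<in>cball x0 r. \<bar>frechet_derivative f (at x) b\<bar> \<le> B" for b
    using compact_imp_bounded[OF compact_continuous_image
        [OF continuous_on_subset[OF Ck_on_1D(2)[OF f, of b] sub] compact_cball]]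
    by (auto simp: bounded_iff)
  then obtain M where M: "\<And>b x. x \<in> cball x0 r \<Longrightarrow> \<bar>frechet_derivative f (at x) b\<bar> \<le> M b"
    by metis
  define B where "B = (\<Sum>b\<in>Basis. \<bar>M b\<bar>) * DIM('e)"
  have der: "(f has_derivative frechet_derivative f (at x)) (at x)" if "x \<in> cball x0 r" for x
    using Ck_on_1D(1)[OF f] sub that by (meson frechet_derivative_works subsetD)
  have "norm (f x - f y) \<le> B * norm (x - y)" if "x \<in> cball x0 r" "y \<in> cball x0 r" for x y
  proof (rule differentiable_bound[OF convex_cball has_derivative_at_withinI[OF der] _ that])
    fix z assume z: "z \<in> cball x0 r"
    have "\<bar>frechet_derivative f (at z) b\<bar> \<le> (\<Sum>b\<in>Basis. \<bar>M b\<bar>)" if "b \<in> Basis" for b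
      using M[OF z, of b] member_le_sum[OF that, of "\<lambda>b. \<bar>M b\<bar>"] by fastforce
    from abs_linear_le_of_basis[OF has_derivative_linear[OF der[OF z]] this]
    show "onorm (frechet_derivative f (at z)) \<le> B"
      unfolding B_def by (intro onorm_bound mult_nonneg_nonneg sum_nonneg) auto
  qed auto
  moreover have "0 \<le> B" by (auto simp: B_def sum_nonneg)
  ultimately show ?thesis using that by auto
qed

section \<open>Two principles for curves\<close>

text \<open>A Gronwall argument: \<open>\<bar>z\<bar>\<^sup>2 exp(- 2 L t)\<close> is nonincreasing, which gives \<open>z = 0\<close> to the right of \<open>t0\<close>, and
\<open>\<bar>z\<bar>\<^sup>2 exp(2 L t)\<close> is nondecreasing, which gives it to the left.\<close>

lemma zero_if_derivative_le:
  fixes z z' :: "real \<Rightarrow> 'b::real_inner"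
  assumes der: "\<And>t. t \<in> {a<..<b} \<Longrightarrow> (z has_vector_derivative z' t) (at t)"
    and le: "\<And>t. t \<in> {a<..<b} \<Longrightarrow> norm (z' t) \<le> L * norm (z t)"
    and t0: "t0 \<in> {a<..<b}" "z t0 = 0" and t: "t \<in> {a<..<b}"
  shows "z t = 0"
proof -
  define E where "E \<sigma> t = (z t \<bullet> z t) * exp (\<sigma> * (2 * L * t))" for \<sigma> t :: real
  have E: "(E \<sigma> has_real_derivative (2 * (z t \<bullet> z' t) + \<sigma> * (2 * L) * (z t \<bullet> z t)) * exp (\<sigma> * (2 * L * t))) (at t)"
    if "t \<in> {a<..<b}" for t \<sigma>
  proof -
    have "((\<lambda>t. z t \<bullet> z t) has_real_derivative 2 * (z t \<bullet> z' t)) (at t)"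
      unfolding has_field_derivative_def
      by (rule has_derivative_eq_rhs[OF has_derivative_inner
            [OF der[OF that, unfolded has_vector_derivative_def]
              der[OF that, unfolded has_vector_derivative_def]]])
        (simp add: fun_eq_iff inner_commute algebra_simps)
    then show ?thesis unfolding E_def
      by (auto intro!: derivative_eq_intros simp: algebra_simps)
  qed
  have zz: "\<bar>z t \<bullet> z' t\<bar> \<le> L * (z t \<bullet> z t)" if "t \<in> {a<..<b}" for t
  proof -
    have "\<bar>z t \<bullet> z' t\<bar> \<le> norm (z t) * (L * norm (z t))"
      by (rule order_trans[OF Cauchy_Schwarz_ineq2 mult_left_mono[OF le[OF that]]]) simp
    then show ?thesis by (simp add: dot_square_norm power2_eq_square mult_ac)
  qed
  \<comment> \<open>The sign \<open>\<sigma>\<close> in the exponent is chosen according to the side of \<open>t0\<close> on which \<open>t\<close> lies.\<close>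
  have "E (if t0 \<le> t then - 1 else 1) t \<le> 0"
  proof (cases "t0 \<le> t")
    case True
    have "E (-1) t \<le> E (-1) t0"
    proof (rule DERIV_nonpos_imp_nonincreasing[OF True])
      fix s assume s: "t0 \<le> s" "s \<le> t"
      then have "s \<in> {a<..<b}" using t t0 by auto
      from E[OF this, of "-1"] zz[OF this]
      show "\<exists>y. (E (-1) has_real_derivative y) (at s) \<and> y \<le> 0"
        by (intro exI[of _ "(2 * (z s \<bullet> z' s) + - 1 * (2 * L) * (z s \<bullet> z s)) * exp (- 1 * (2 * L * s))"] conjI)
          (auto intro!: mult_nonpos_nonneg)
    qed
    then show ?thesis using True t0 by (simp add: E_def)
  next
    case False
    have "E 1 t \<le> E 1 t0"
    proof (rule DERIV_nonneg_imp_nondecreasing[of t t0 "E 1"])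
      show "t \<le> t0" using False by simp
      fix s assume s: "t \<le> s" "s \<le> t0"
      then have "s \<in> {a<..<b}" using t t0 by auto
      from E[OF this, of 1] zz[OF this]
      show "\<exists>y. (E 1 has_real_derivative y) (at s) \<and> 0 \<le> y"
        by (intro exI[of _ "(2 * (z s \<bullet> z' s) + 1 * (2 * L) * (z s \<bullet> z s)) * exp (1 * (2 * L * s))"] conjI)
          (auto intro!: mult_nonneg_nonneg)
    qed
    then show ?thesis using False t0 by (simp add: E_def)
  qed
  then have "z t \<bullet> z t \<le> 0"
    by (auto simp: E_def mult_le_0_iff not_le split: if_splits)
  then show ?thesis by (metis inner_ge_zero inner_eq_zero_iff antisym)
qed

text \<open>A continuity argument for an a priori bound: as long as the weak bound \<open>P\<close> has held, the strong bound \<open>Q\<close>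
holds, and \<open>Q\<close> is strong enough to keep \<open>P\<close> alive a little longer. At the infimum of the times
where \<open>P\<close> fails this is contradictory.\<close>

lemma bootstrap_on_interval:
  fixes P Q :: "real \<Rightarrow> bool"
  assumes spread: "\<And>t. 0 \<le> t \<Longrightarrow> t \<le> T \<Longrightarrow> Q t \<Longrightarrow> \<forall>\<^sub>F s in nhds t. P s"
    and improving: "\<And>t. 0 \<le> t \<Longrightarrow> t \<le> T \<Longrightarrow> (\<And>s. 0 \<le> s \<Longrightarrow> s < t \<Longrightarrow> P s) \<Longrightarrow> Q t"
    and t: "0 \<le> t" "t \<le> T"
  shows "Q t"
proof (rule improving[OF t])
  fix s assume s: "0 \<le> s" "s < t"
  show "P s"
  proof (rule ccontr)
    assume "\<not> P s"
    define B where "B = {s. 0 \<le> s \<and> s \<le> T \<and> \<not> P s}"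
    have sB: "s \<in> B" using s t \<open>\<not> P s\<close> by (simp add: B_def)
    have bdd: "bdd_below B" by (auto simp: B_def bdd_below_def)
    define m where "m = Inf B"
    have m0: "0 \<le> m" unfolding m_def by (rule cInf_greatest) (use sB in \<open>auto simp: B_def\<close>)
    have mT: "m \<le> T" using cInf_lower[OF sB bdd] s t unfolding m_def by linarith
    have "P u" if "0 \<le> u" "u < m" for u
      using cInf_lower[OF _ bdd, of u] that mT by (force simp: B_def m_def)
    then have "\<forall>\<^sub>F s in nhds m. P s"
      using m0 mT improving spread by blast
    then obtain d where d: "d > 0" "\<And>u. dist u m < d \<Longrightarrow> P u"
      by (auto simp: eventually_nhds_metric)
    obtain u where "u \<in> B" "u < m + d"
      using cInf_lessD[of B "m + d"] sB d(1) unfolding m_def by auto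
    moreover have "m \<le> u" using cInf_lower[OF \<open>u \<in> B\<close> bdd] by (simp add: m_def)
    ultimately show False using d(2)[of u] by (auto simp: B_def dist_real_def)
  qed
qed

section \<open>The geodesic equation in coordinates\<close>

text \<open>The right-hand side of Koszul's formula with both directions equal to \<open>u\<close>. The geodesic equation only involves
the Christoffel symbols on the diagonal, so this case suffices; the sum of two equal terms is kept so that
\<open>christoffel_diagonal\<close> holds by unfolding.\<close>

definition koszul :: "('e::euclidean_space \<Rightarrow> 'e \<Rightarrow> 'e \<Rightarrow> real) \<Rightarrow> 'e \<Rightarrow> 'e \<Rightarrow> 'e \<Rightarrow> real" where
  "koszul G x u z =
     (frechet_derivative (\<lambda>x. G x u z) (at x) u + frechet_derivative (\<lambda>x. G x u z) (at x) u
      - frechet_derivative (\<lambda>x. G x u u) (at x) z) / 2"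

text \<open>The quadratic vector field \<open>\<Gamma>(u, u)\<close>; a geodesic has coordinate acceleration \<open>- spray G x x'\<close>.\<close>

definition spray :: "('e::euclidean_space \<Rightarrow> 'e \<Rightarrow> 'e \<Rightarrow> real) \<Rightarrow> 'e \<Rightarrow> 'e \<Rightarrow> 'e" where
  "spray G x u = (THE y. \<forall>z. G x y z = koszul G x u z)"

lemma christoffel_diagonal: "christoffel A g c x u u = spray (metric_in A g c) x u"
  unfolding christoffel_def spray_def koszul_def ..

locale coordinate_metric =
  fixes S :: "'e::euclidean_space set" and G :: "'e \<Rightarrow> 'e \<Rightarrow> 'e \<Rightarrow> real"
  assumes open_S: "open S"
    and linear_left: "x \<in> S \<Longrightarrow> linear (\<lambda>u. G x u w)"
    and sym: "x \<in> S \<Longrightarrow> G x u w = G x w u"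
    and pos: "x \<in> S \<Longrightarrow> u \<noteq> 0 \<Longrightarrow> 0 < G x u u"
    and C2: "Ck_on 2 S (\<lambda>x. G x u w)"
begin

lemma linear_right: "x \<in> S \<Longrightarrow> linear (G x u)"
  using linear_left[of x u] sym[of x u, THEN ext[of "G x u"]] by simp

lemmas G_left = linear_add[OF linear_left] linear_scale[OF linear_left] linear_diff[OF linear_left]
  linear_0[OF linear_left]
lemmas G_right = linear_add[OF linear_right] linear_scale[OF linear_right]
  linear_diff[OF linear_right] linear_0[OF linear_right]

lemma nondegenerate: "x \<in> S \<Longrightarrow> G x y = G x y' \<Longrightarrow> y = y'"
  using pos[of x "y - y'"] G_left(3)[of x y y' "y - y'"] by fastforce

text \<open>A nondegenerate form makes \<open>y \<mapsto> (G x y b)\<^sub>b\<close> an injective linear endomorphism of a finite-dimensional space,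
hence a surjective one.\<close>

lemma riesz_representation:
  assumes x: "x \<in> S" and h: "linear h"
  shows "\<exists>!y. \<forall>z. G x y z = h z"
proof -
  define T where "T u = (\<Sum>b\<in>Basis. G x u b *\<^sub>R b)" for u
  have T: "linear T"
    unfolding T_def using x
    by (intro linear_compose_sum ballI linearI) (auto simp: G_left algebra_simps)
  have basis_ext: "k = k'" if "linear k" "linear k'" "\<And>b. b \<in> Basis \<Longrightarrow> k b = k' b" for k k' :: "'e \<Rightarrow> real"
    using linear_eq_on_span[OF that(1,2), of Basis] that(3) by (auto simp: span_Basis)
  have Tb: "T u \<bullet> b = G x u b" if "b \<in> Basis" for u b
    using that by (simp add: T_def)
  have "inj T"
  proof (rule injI)
    fix u v assume "T u = T v"
    then have "G x u = G x v"
      by (intro basis_ext linear_right x) (metis Tb)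
    then show "u = v" by (rule nondegenerate[OF x])
  qed
  then obtain y where "T y = (\<Sum>b\<in>Basis. h b *\<^sub>R b)"
    using linear_injective_imp_surjective[OF T] by (metis surjD)
  then have "G x y b = h b" if "b \<in> Basis" for b
    using Tb[OF that, of y] that by simp
  then have "G x y = h" by (intro basis_ext linear_right x h)
  moreover have "y' = y" if "\<forall>z. G x y' z = h z" for y'
    by (rule nondegenerate[OF x]) (use that \<open>G x y = h\<close> in auto)
  ultimately show ?thesis by blast
qed

abbreviation DG :: "'e \<Rightarrow> 'e \<Rightarrow> 'e \<Rightarrow> 'e \<Rightarrow> real" where
  "DG x a b h \<equiv> frechet_derivative (\<lambda>x. G x a b) (at x) h"

lemma has_derivative_G: "x \<in> S \<Longrightarrow> ((\<lambda>x. G x a b) has_derivative DG x a b) (at x)"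
  using Ck_on_2D(1)[OF C2] by (simp add: frechet_derivative_works)

lemma DG_eqI:
  assumes x: "x \<in> S" and "(f has_derivative f') (at x)" "\<And>y. y \<in> S \<Longrightarrow> G y a b = f y"
  shows "DG x a b = f'"
  using has_derivative_transform_within_open[OF assms(2) open_S x] assms(3)
  by (metis frechet_derivative_at)

lemma linear_DG:
  assumes x: "x \<in> S"
  shows "linear (\<lambda>a. DG x a b h)" "linear (\<lambda>b. DG x a b h)" "linear (DG x a b)"
proof -
  note der = has_derivative_G[OF x]
  show "linear (\<lambda>a. DG x a b h)"
  proof (rule linearI)
    show "DG x (a1 + a2) b h = DG x a1 b h + DG x a2 b h" for a1 a2
      using DG_eqI[OF x has_derivative_add[OF der der], of "a1 + a2" b a1 b a2 b] by (simp add: G_left)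
    show "DG x (r *\<^sub>R a) b h = r *\<^sub>R DG x a b h" for r a
      using DG_eqI[OF x has_derivative_scaleR_right[OF der], of "r *\<^sub>R a" b r a b] by (simp add: G_left)
  qed
  show "linear (\<lambda>b. DG x a b h)"
  proof (rule linearI)
    show "DG x a (b1 + b2) h = DG x a b1 h + DG x a b2 h" for b1 b2
      using DG_eqI[OF x has_derivative_add[OF der der], of a "b1 + b2" a b1 a b2] by (simp add: G_right)
    show "DG x a (r *\<^sub>R b) h = r *\<^sub>R DG x a b h" for r b
      using DG_eqI[OF x has_derivative_scaleR_right[OF der], of a "r *\<^sub>R b" r a b] by (simp add: G_right)
  qed
  show "linear (DG x a b)" using der by (rule has_derivative_linear)
qed

lemma linear_koszul: "x \<in> S \<Longrightarrow> linear (koszul G x u)"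
  unfolding koszul_def
  by (rule linearI) (simp_all add: linear_add[OF linear_DG(2)] linear_add[OF linear_DG(3)]
      linear_scale[OF linear_DG(2)] linear_scale[OF linear_DG(3)] field_simps)

lemma spray: "x \<in> S \<Longrightarrow> G x (spray G x u) z = koszul G x u z"
  unfolding spray_def using theI'[OF riesz_representation[OF _ linear_koszul]] by blast

text \<open>This homogeneity is what makes a rescaling of the parameter preserve geodesics.\<close>

lemma spray_scaleR:
  assumes x: "x \<in> S"
  shows "spray G x (r *\<^sub>R u) = r\<^sup>2 *\<^sub>R spray G x u"
proof (rule nondegenerate[OF x], rule ext)
  fix z
  show "G x (spray G x (r *\<^sub>R u)) z = G x (r\<^sup>2 *\<^sub>R spray G x u) z"
    unfolding G_left[OF x] spray[OF x] koszul_def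
    by (simp add: linear_scale[OF linear_DG(1)[OF x]] linear_scale[OF linear_DG(2)[OF x]]
        linear_scale[OF linear_DG(3)[OF x]] power2_eq_square algebra_simps)
qed

lemma continuous_on_G:
  "continuous_on (S \<times> UNIV) (\<lambda>(x, w). G x w w)"
proof -
  have eq: "G x w w = (\<Sum>b\<in>Basis. \<Sum>b'\<in>Basis. (w \<bullet> b) * (w \<bullet> b') * G x b b')" if x: "x \<in> S" for x w
  proof -
    have "G x w w = G x (\<Sum>b\<in>Basis. (w \<bullet> b) *\<^sub>R b) (\<Sum>b\<in>Basis. (w \<bullet> b) *\<^sub>R b)"
      by (simp add: euclidean_representation)
    also have "\<dots> = (\<Sum>b\<in>Basis. \<Sum>b'\<in>Basis. (w \<bullet> b) * (w \<bullet> b') * G x b b')"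
      by (subst linear_sum[OF linear_left[OF x]], subst linear_sum[OF linear_right[OF x]])
        (simp add: G_left[OF x] G_right[OF x] mult_ac)
    finally show ?thesis .
  qed
  have "continuous_on (S \<times> UNIV) (\<lambda>p. G (fst p) b b')" for b b'
    by (intro continuous_on_compose2[OF Ck_on_1_imp_continuous_on[OF Ck_on_2D(3)[OF C2]]]
        continuous_intros) auto
  then have "continuous_on (S \<times> UNIV)
      (\<lambda>p. \<Sum>b\<in>Basis. \<Sum>b'\<in>Basis. (snd p \<bullet> b) * (snd p \<bullet> b') * G (fst p) b b')"
    by (intro continuous_intros)
  then show ?thesis
    by (rule continuous_on_eq) (auto simp: eq)
qed

lemma continuous_at_G: "x \<in> S \<Longrightarrow> isCont (\<lambda>x. G x u w) x"
  using Ck_on_2D(1)[OF C2] differentiable_imp_continuous_within by blast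

text \<open>The constant is the minimum of \<open>G x w w\<close> over the compact set of points of the ball and unit vectors.\<close>

lemma coercive:
  assumes sub: "cball x0 r \<subseteq> S"
  obtains l where "0 < l" "\<And>x w. x \<in> cball x0 r \<Longrightarrow> l * (norm w)\<^sup>2 \<le> G x w w"
proof (cases "cball x0 r = {}")
  case True
  then show ?thesis using that[of 1] by simp
next
  case False
  let ?K = "cball x0 r \<times> sphere (0::'e) 1"
  have "continuous_on ?K (\<lambda>(x, w). G x w w)"
    by (rule continuous_on_subset[OF continuous_on_G]) (use sub in auto)
  moreover have "compact ?K" by (intro compact_Times) auto
  moreover have "?K \<noteq> {}" using False by (simp add: sphere_eq_empty)
  ultimately obtain x1 w1 where 1: "(x1, w1) \<in> ?K"
    and min: "\<And>x w. (x, w) \<in> ?K \<Longrightarrow> G x1 w1 w1 \<le> G x w w"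
    using continuous_attains_inf[of ?K "\<lambda>(x, w). G x w w"] by fastforce
  have "0 < G x1 w1 w1" using 1 sub by (intro pos) auto
  moreover have "G x1 w1 w1 * (norm w)\<^sup>2 \<le> G x w w" if "x \<in> cball x0 r" for x w
  proof (cases "w = 0")
    case True
    then show ?thesis using that sub by (auto simp: G_left)
  next
    case False
    have "G x1 w1 w1 \<le> G x (w /\<^sub>R norm w) (w /\<^sub>R norm w)"
      using that False by (intro min) auto
    then show ?thesis using that sub False
      by (auto simp: G_left G_right power2_eq_square field_simps)
  qed
  ultimately show ?thesis by (rule that)
qed

text \<open>Only finitely many functions matter, the values of \<open>G\<close> and \<open>DG\<close> at basis vectors. They are of class \<open>C\<^sup>1\<close>
because \<open>G\<close> is of class \<open>C\<^sup>2\<close>, and multilinearity extends the bounds to all vectors.\<close>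

lemma locally_lipschitz_G:
  assumes sub: "cball x0 r \<subseteq> S"
  obtains M where "0 \<le> M"
    "\<And>x a b h. x \<in> cball x0 r \<Longrightarrow> \<bar>DG x a b h\<bar> \<le> M * norm a * norm b * norm h"
    "\<And>x y u w. x \<in> cball x0 r \<Longrightarrow> y \<in> cball x0 r \<Longrightarrow>
       \<bar>G x u w - G y u w\<bar> \<le> M * norm (x - y) * norm u * norm w"
    "\<And>x y a b h. x \<in> cball x0 r \<Longrightarrow> y \<in> cball x0 r \<Longrightarrow>
       \<bar>DG x a b h - DG y a b h\<bar> \<le> M * norm (x - y) * norm a * norm b * norm h"
proof -
  let ?K = "cball x0 r"
  have bdd: "\<exists>C\<ge>0. (\<forall>x\<in>?K. \<bar>f x\<bar> \<le> C) \<and> (\<forall>x\<in>?K. \<forall>y\<in>?K. \<bar>f x - f y\<bar> \<le> C * norm (x - y))"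
    if f: "Ck_on 1 S f" for f :: "'e \<Rightarrow> real"
  proof -
    obtain C1 where C1: "\<And>x. x \<in> ?K \<Longrightarrow> \<bar>f x\<bar> \<le> C1"
      using compact_imp_bounded[OF compact_continuous_image
          [OF continuous_on_subset[OF Ck_on_1_imp_continuous_on[OF f] sub] compact_cball]]
      by (auto simp: bounded_iff simp del: mem_cball)
    obtain C2 where C2: "0 \<le> C2" "\<And>x y. x \<in> ?K \<Longrightarrow> y \<in> ?K \<Longrightarrow> \<bar>f x - f y\<bar> \<le> C2 * norm (x - y)"
      using Ck_on_1_lipschitz[OF f sub] by blast
    have "\<bar>f x\<bar> \<le> \<bar>C1\<bar> + C2" if "x \<in> ?K" for x using C1[OF that] C2(1) by linarith
    moreover have "\<bar>f x - f y\<bar> \<le> (\<bar>C1\<bar> + C2) * norm (x - y)" if "x \<in> ?K" "y \<in> ?K" for x y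
      using C2(2)[OF that] by (rule order_trans) (simp add: mult_right_mono)
    ultimately show ?thesis using C2(1) by (intro exI[of _ "\<bar>C1\<bar> + C2"]) auto
  qed
  obtain P where P: "\<And>b b'. P b b' \<ge> 0"
    "\<And>b b' x y. x \<in> ?K \<Longrightarrow> y \<in> ?K \<Longrightarrow> \<bar>G x b b' - G y b b'\<bar> \<le> P b b' * norm (x - y)"
    using bdd[OF Ck_on_2D(3)[OF C2]] by metis
  obtain Q where Q: "\<And>b b' h. Q b b' h \<ge> 0" "\<And>b b' h x. x \<in> ?K \<Longrightarrow> \<bar>DG x b b' h\<bar> \<le> Q b b' h"
    "\<And>b b' h x y. x \<in> ?K \<Longrightarrow> y \<in> ?K \<Longrightarrow> \<bar>DG x b b' h - DG y b b' h\<bar> \<le> Q b b' h * norm (x - y)"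
    using bdd[OF Ck_on_2D(2)[OF C2]] by metis
  define N where "N = (\<Sum>b\<in>Basis. \<Sum>b'\<in>Basis. P b b') + (\<Sum>b\<in>Basis. \<Sum>b'\<in>Basis. \<Sum>h\<in>Basis. Q b b' h)"
  have PN: "P b b' \<le> N" if "b \<in> Basis" "b' \<in> Basis" for b b'
  proof -
    have "P b b' \<le> (\<Sum>b'\<in>Basis. P b b')"
      using that P(1) by (intro member_le_sum) auto
    also have "\<dots> \<le> (\<Sum>b\<in>Basis. \<Sum>b'\<in>Basis. P b b')"
      using that P(1) by (intro member_le_sum[of b Basis "\<lambda>b. \<Sum>b'\<in>Basis. P b b'"]) (auto intro: sum_nonneg)
    also have "\<dots> \<le> N" using Q(1) by (auto simp: N_def intro!: sum_nonneg)
    finally show ?thesis .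
  qed
  have QN: "Q b b' h \<le> N" if "b \<in> Basis" "b' \<in> Basis" "h \<in> Basis" for b b' h
  proof -
    have "Q b b' h \<le> (\<Sum>h\<in>Basis. Q b b' h)"
      using that Q(1) by (intro member_le_sum) auto
    also have "\<dots> \<le> (\<Sum>b'\<in>Basis. \<Sum>h\<in>Basis. Q b b' h)"
      using that Q(1) by (intro member_le_sum[of b' Basis "\<lambda>b'. \<Sum>h\<in>Basis. Q b b' h"]) (auto intro: sum_nonneg)
    also have "\<dots> \<le> (\<Sum>b\<in>Basis. \<Sum>b'\<in>Basis. \<Sum>h\<in>Basis. Q b b' h)"
      using that Q(1) by (intro member_le_sum[of b Basis "\<lambda>b. \<Sum>b'\<in>Basis. \<Sum>h\<in>Basis. Q b b' h"]) (auto intro!: sum_nonneg)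
    also have "\<dots> \<le> N" using P(1) by (auto simp: N_def intro!: sum_nonneg)
    finally show ?thesis .
  qed
  have N0: "0 \<le> N" using P(1) Q(1) by (auto simp: N_def intro!: add_nonneg_nonneg sum_nonneg)
  define D where "D = real (DIM('e) ^ 3)"
  have D: "real (DIM('e) ^ 2) \<le> D"
    unfolding D_def of_nat_le_iff by (intro power_increasing) auto
  define M where "M = N * D"
  have le: "C * real (DIM('e) ^ 2) * norm u * norm w \<le> C * D * norm u * norm w"
    if "0 \<le> C" for C and u w :: 'e
    using that D by (intro mult_right_mono mult_left_mono) auto
  show ?thesis
  proof (rule that[of M])
    show "0 \<le> M" using N0 by (simp add: M_def D_def)
    fix x y :: 'e
    assume x: "x \<in> ?K"
    then have xS: "x \<in> S" using sub by auto
    show "\<bar>DG x a b h\<bar> \<le> M * norm a * norm b * norm h" for a b h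
      unfolding M_def D_def
      by (rule abs_trilinear_le_of_basis[OF linear_DG[OF xS]])
        (use Q(2)[OF x] QN in \<open>blast intro: order_trans\<close>)
    assume y: "y \<in> ?K"
    then have yS: "y \<in> S" using sub by auto
    have NN: "0 \<le> N * norm (x - y)" using N0 by simp
    have "\<bar>G x u w - G y u w\<bar> \<le> (N * norm (x - y)) * D * norm u * norm w" for u w
    proof (rule order_trans[OF abs_bilinear_le_of_basis[OF _ _] le[OF NN]])
      show "linear (\<lambda>u. G x u w - G y u w)" "linear (\<lambda>w. G x u w - G y u w)" for u w
        by (intro linear_compose_sub linear_left linear_right xS yS)+
      show "\<bar>G x b b' - G y b b'\<bar> \<le> N * norm (x - y)" if "b \<in> Basis" "b' \<in> Basis" for b b'
        using P(2)[OF x y, of b b'] mult_right_mono[OF PN[OF that], of "norm (x - y)"] by simp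
    qed
    then show "\<bar>G x u w - G y u w\<bar> \<le> M * norm (x - y) * norm u * norm w" for u w
      by (simp add: M_def mult_ac)
    have "\<bar>DG x a b h - DG y a b h\<bar> \<le> (N * norm (x - y)) * D * norm a * norm b * norm h" for a b h
      unfolding D_def
    proof (rule abs_trilinear_le_of_basis)
      show "linear (\<lambda>a. DG x a b h - DG y a b h)" "linear (\<lambda>b. DG x a b h - DG y a b h)"
        "linear (\<lambda>h. DG x a b h - DG y a b h)" for a b h
        by (intro linear_compose_sub linear_DG xS yS)+
      show "\<bar>DG x b b' h - DG y b b' h\<bar> \<le> N * norm (x - y)" if "b \<in> Basis" "b' \<in> Basis" "h \<in> Basis" for b b' h
        using Q(3)[OF x y, of b b' h] mult_right_mono[OF QN[OF that], of "norm (x - y)"] by simp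
    qed
    then show "\<bar>DG x a b h - DG y a b h\<bar> \<le> M * norm (x - y) * norm a * norm b * norm h" for a b h
      by (simp add: M_def mult_ac)
  qed
qed

text \<open>Coercivity lets the defining equation \<open>G x (spray G x u) z = koszul G x u z\<close>, tested with \<open>z = spray G x u\<close>,
bound the spray without inverting the metric.\<close>

lemma spray_bound:
  assumes sub: "cball x0 r \<subseteq> S"
  obtains C where "0 < C" "\<And>x u. x \<in> cball x0 r \<Longrightarrow> norm (spray G x u) \<le> C * (norm u)\<^sup>2"
proof -
  obtain l where l: "0 < l" "\<And>x w. x \<in> cball x0 r \<Longrightarrow> l * (norm w)\<^sup>2 \<le> G x w w"
    using coercive[OF sub] by blast
  obtain M where M: "0 \<le> M"
    "\<And>x a b h. x \<in> cball x0 r \<Longrightarrow> \<bar>DG x a b h\<bar> \<le> M * norm a * norm b * norm h"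
    using locally_lipschitz_G[OF sub] by metis
  have "norm (spray G x u) \<le> (3 * M / 2 / l + 1) * (norm u)\<^sup>2" if x: "x \<in> cball x0 r" for x u
  proof -
    let ?y = "spray G x u"
    have "l * (norm ?y)\<^sup>2 \<le> koszul G x u ?y"
      using l(2)[OF x, of ?y] spray[of x u ?y] x sub by auto
    also have "\<dots> \<le> 3 / 2 * M * (norm u)\<^sup>2 * norm ?y"
      using M(2)[OF x, of u ?y u] M(2)[OF x, of u u ?y]
      unfolding koszul_def by (simp add: power2_eq_square mult_ac)
    finally have "l * norm ?y * norm ?y \<le> (3 / 2 * M * (norm u)\<^sup>2) * norm ?y"
      by (simp add: power2_eq_square mult_ac)
    then have "l * norm ?y \<le> 3 / 2 * M * (norm u)\<^sup>2"
      using M(1) by (cases "?y = 0") auto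
    then have "norm ?y \<le> 3 / 2 * M * (norm u)\<^sup>2 / l"
      using l(1) by (simp add: field_simps)
    also have "\<dots> \<le> (3 * M / 2 / l + 1) * (norm u)\<^sup>2"
      by (simp add: algebra_simps)
    finally show ?thesis .
  qed
  moreover have "0 < 3 * M / 2 / l + 1" using M(1) l(1) by (simp add: add_nonneg_pos)
  ultimately show ?thesis using that by blast
qed

text \<open>For \<open>d = spray G x u - spray G y w\<close>, subtracting the two defining equations expresses \<open>G x d d\<close> through
differences of \<open>koszul\<close> and of \<open>G\<close>, which are Lipschitz; coercivity turns this into a bound on \<open>d\<close>.\<close>

lemma spray_lipschitz:
  assumes sub: "cball x0 r \<subseteq> S"
  obtains L where "\<And>x y u w. x \<in> cball x0 r \<Longrightarrow> y \<in> cball x0 r \<Longrightarrow> norm u \<le> R \<Longrightarrow> norm w \<le> R \<Longrightarrow>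
    norm (spray G x u - spray G y w) \<le> L * (norm (x - y) + norm (u - w))"
proof -
  obtain l where l: "0 < l" "\<And>x w. x \<in> cball x0 r \<Longrightarrow> l * (norm w)\<^sup>2 \<le> G x w w"
    using coercive[OF sub] by blast
  obtain M where M: "0 \<le> M"
    "\<And>x a b h. x \<in> cball x0 r \<Longrightarrow> \<bar>DG x a b h\<bar> \<le> M * norm a * norm b * norm h"
    "\<And>x y u w. x \<in> cball x0 r \<Longrightarrow> y \<in> cball x0 r \<Longrightarrow>
       \<bar>G x u w - G y u w\<bar> \<le> M * norm (x - y) * norm u * norm w"
    "\<And>x y a b h. x \<in> cball x0 r \<Longrightarrow> y \<in> cball x0 r \<Longrightarrow>
       \<bar>DG x a b h - DG y a b h\<bar> \<le> M * norm (x - y) * norm a * norm b * norm h"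
    using locally_lipschitz_G[OF sub] by metis
  obtain C where C: "0 < C" "\<And>x u. x \<in> cball x0 r \<Longrightarrow> norm (spray G x u) \<le> C * (norm u)\<^sup>2"
    using spray_bound[OF sub] by blast
  define L1 where "L1 = 3 / 2 * M * R\<^sup>2 + M * C * R\<^sup>2"
  define L2 where "L2 = 3 * M * R"
  define L where "L = (max L1 L2) / l"
  show ?thesis
  proof (rule that[of L])
    fix x y u w :: 'e
    assume x: "x \<in> cball x0 r" and y: "y \<in> cball x0 r" and u: "norm u \<le> R" and w: "norm w \<le> R"
    then have xS: "x \<in> S" and yS: "y \<in> S" using sub by auto
    have R: "0 \<le> R" using u norm_ge_zero order_trans by blast
    define d where "d = spray G x u - spray G y w"
    have trilin: "\<bar>DG x a b h - DG y a' b' h'\<bar> \<le> M * norm (x - y) * norm a * norm b * norm h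
        + M * norm (a - a') * norm b * norm h + M * norm a' * norm (b - b') * norm h
        + M * norm a' * norm b' * norm (h - h')" for a b h a' b' h'
    proof -
      have "DG x a b h - DG y a' b' h' = (DG x a b h - DG y a b h) + DG y (a - a') b h
          + DG y a' (b - b') h + DG y a' b' (h - h')"
        by (simp add: linear_diff[OF linear_DG(1)[OF yS]] linear_diff[OF linear_DG(2)[OF yS]]
            linear_diff[OF linear_DG(3)[OF yS]])
      then show ?thesis
        using M(4)[OF x y, of a b h] M(2)[OF y, of "a - a'" b h] M(2)[OF y, of a' "b - b'" h]
          M(2)[OF y, of a' b' "h - h'"] by linarith
    qed
    have "l * (norm d)\<^sup>2 \<le> G x d d" by (rule l(2)[OF x])
    also have "G x d d = koszul G x u d - koszul G y w d + (G y (spray G y w) d - G x (spray G y w) d)"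
      unfolding d_def by (simp add: G_left[OF xS] spray[OF xS] spray[OF yS])
    also have "G y (spray G y w) d - G x (spray G y w) d \<le> M * norm (x - y) * (C * R\<^sup>2) * norm d"
    proof -
      have "norm (spray G y w) \<le> C * R\<^sup>2"
        by (rule order_trans[OF C(2)[OF y]]) (use C(1) w in \<open>auto intro!: mult_left_mono power_mono\<close>)
      then have "M * norm (x - y) * norm (spray G y w) * norm d \<le> M * norm (x - y) * (C * R\<^sup>2) * norm d"
        using M(1) by (intro mult_right_mono mult_left_mono) auto
      then show ?thesis using M(3)[OF y x, of "spray G y w" d] by (simp add: norm_minus_commute)
    qed
    also have "koszul G x u d - koszul G y w d
        \<le> 3 / 2 * (M * norm (x - y) * R\<^sup>2 + 2 * M * R * norm (u - w)) * norm d"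
    proof -
      have a: "M * norm (x - y) * norm u * norm d * norm u \<le> M * norm (x - y) * R\<^sup>2 * norm d"
        "M * norm (x - y) * norm u * norm u * norm d \<le> M * norm (x - y) * R\<^sup>2 * norm d"
      proof -
        have "norm u * norm u \<le> R\<^sup>2" using u R by (simp add: power2_eq_square mult_mono)
        then have "(M * norm (x - y) * norm d) * (norm u * norm u) \<le> (M * norm (x - y) * norm d) * R\<^sup>2"
          using M(1) by (intro mult_left_mono) auto
        then show "M * norm (x - y) * norm u * norm d * norm u \<le> M * norm (x - y) * R\<^sup>2 * norm d"
          "M * norm (x - y) * norm u * norm u * norm d \<le> M * norm (x - y) * R\<^sup>2 * norm d"
          by (simp_all add: mult_ac)
      qed
      have b: "M * norm (u - w) * norm d * s \<le> M * R * norm (u - w) * norm d" if "s \<le> R" for s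
      proof -
        have "(M * norm (u - w) * norm d) * s \<le> (M * norm (u - w) * norm d) * R"
          using M(1) that by (intro mult_left_mono) auto
        then show ?thesis by (simp add: mult_ac)
      qed
      have "DG x u d u - DG y w d w \<le> (M * norm (x - y) * R\<^sup>2 + 2 * M * R * norm (u - w)) * norm d"
        using trilin[of u d u w d w] a(1) b[OF u] b[OF w] by (simp add: algebra_simps)
      moreover have "\<bar>DG x u u d - DG y w w d\<bar> \<le> (M * norm (x - y) * R\<^sup>2 + 2 * M * R * norm (u - w)) * norm d"
        using trilin[of u u d w w d] a(2) b[OF u] b[OF w] by (simp add: algebra_simps)
      ultimately show ?thesis unfolding koszul_def by (simp add: field_simps)
    qed
    finally have "l * (norm d)\<^sup>2 \<le> (L1 * norm (x - y) + L2 * norm (u - w)) * norm d"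
      by (simp add: L1_def L2_def algebra_simps)
    also have "\<dots> \<le> (max L1 L2 * (norm (x - y) + norm (u - w))) * norm d"
      unfolding distrib_left by (intro mult_right_mono add_mono) auto
    finally have le: "(l * norm d) * norm d \<le> (max L1 L2 * (norm (x - y) + norm (u - w))) * norm d"
      by (simp add: power2_eq_square mult_ac)
    have "0 \<le> max L1 L2 * (norm (x - y) + norm (u - w))"
      using M(1) R by (auto simp: L2_def le_max_iff_disj intro!: mult_nonneg_nonneg)
    with le have "l * norm d \<le> max L1 L2 * (norm (x - y) + norm (u - w))"
      by (cases "d = 0") auto
    then show "norm (spray G x u - spray G y w) \<le> L * (norm (x - y) + norm (u - w))"
      using l(1) unfolding d_def[symmetric] L_def by (simp add: field_simps)
  qed
qed

text \<open>Local uniqueness for \<open>x'' + \<Gamma>(x', x') = 0\<close>: near \<open>t0\<close> both solutions stay in a region where the spray is Lipschitz, so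
the difference of the phase space curves \<open>(x, x')\<close> and \<open>(y, y')\<close> falls under \<open>zero_if_derivative_le\<close>.\<close>

lemma spray_ode_unique:
  assumes t0: "t0 \<in> {a<..<b}" and init: "x t0 = y t0" "x' t0 = y' t0"
    and x: "\<And>t. t \<in> {a<..<b} \<Longrightarrow> x t \<in> S \<and> (x has_vector_derivative x' t) (at t) \<and>
        (x' has_vector_derivative - spray G (x t) (x' t)) (at t)"
    and y: "\<And>t. t \<in> {a<..<b} \<Longrightarrow> y t \<in> S \<and> (y has_vector_derivative y' t) (at t) \<and>
        (y' has_vector_derivative - spray G (y t) (y' t)) (at t)"
  shows "\<forall>\<^sub>F t in nhds t0. x t = y t"
proof -
  obtain r where r: "r > 0" "cball (x t0) r \<subseteq> S"
    using open_S x[OF t0] open_contains_cball by blast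
  define R where "R = norm (x' t0) + 1"
  obtain L where L: "\<And>p q u w. p \<in> cball (x t0) r \<Longrightarrow> q \<in> cball (x t0) r \<Longrightarrow> norm u \<le> R \<Longrightarrow> norm w \<le> R \<Longrightarrow>
    norm (spray G p u - spray G q w) \<le> L * (norm (p - q) + norm (u - w))"
    using spray_lipschitz[OF r(2)] by metis
  have near: "\<forall>\<^sub>F t in nhds t0. f t \<in> ball (f t0) e" if "(f has_vector_derivative D) (at t0)" "e > 0"
    for f D and e :: real
  proof -
    have "isCont f t0" using that(1) has_vector_derivative_continuous by blast
    then show ?thesis
      using that(2) unfolding continuous_at_eps_delta eventually_nhds_metric
      by (simp add: dist_commute)
  qed
  have 1: "norm v \<le> R" if "v \<in> ball (x' t0) 1" for v
    using norm_triangle_sub[of v "x' t0"] that by (simp add: R_def dist_norm norm_minus_commute)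
  have "\<forall>\<^sub>F t in nhds t0. t \<in> {a<..<b} \<and> x t \<in> ball (x t0) r \<and> y t \<in> ball (x t0) r \<and>
      x' t \<in> ball (x' t0) 1 \<and> y' t \<in> ball (x' t0) 1"
    using near[of x _ r] near[of y _ r] near[of x' _ 1] near[of y' _ 1] x[OF t0] y[OF t0] r(1)
    by (intro eventually_conj eventually_nhds_in_open t0) (auto simp: init)
  then obtain d where d: "d > 0" "\<And>t. dist t t0 < d \<Longrightarrow> t \<in> {a<..<b} \<and> x t \<in> ball (x t0) r \<and> y t \<in> ball (x t0) r \<and>
      x' t \<in> ball (x' t0) 1 \<and> y' t \<in> ball (x' t0) 1"
    by (auto simp: eventually_nhds_metric)
  have eq: "x t = y t" if "dist t t0 < d" for t
  proof -
    let ?z = "\<lambda>t. (x t - y t, x' t - y' t)"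
    have "?z t = 0"
    proof (rule zero_if_derivative_le[where a = "t0 - d" and b = "t0 + d" and ?t0.0 = t0
          and z' = "\<lambda>t. (x' t - y' t, - spray G (x t) (x' t) - (- spray G (y t) (y' t)))"
          and L = "1 + 2 * \<bar>L\<bar>"])
      fix s assume "s \<in> {t0 - d<..<t0 + d}"
      then have s: "dist s t0 < d" by (auto simp: dist_real_def)
      note ds = d(2)[OF s]
      show "(?z has_vector_derivative (x' s - y' s, - spray G (x s) (x' s) - (- spray G (y s) (y' s)))) (at s)"
        using x[of s] y[of s] ds
        by (intro has_vector_derivative_Pair has_vector_derivative_diff) auto
      have n: "norm (x s - y s) \<le> norm (?z s)" "norm (x' s - y' s) \<le> norm (?z s)"
        using norm_fst_le[of "x s - y s" "x' s - y' s"] norm_snd_le[of "x' s - y' s" "x s - y s"] by auto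
      have "norm (spray G (x s) (x' s) - spray G (y s) (y' s)) \<le> L * (norm (x s - y s) + norm (x' s - y' s))"
        by (rule L) (use ds 1 in auto)
      also have "\<dots> \<le> \<bar>L\<bar> * (norm (x s - y s) + norm (x' s - y' s))"
        by (intro mult_right_mono) auto
      also have "\<dots> \<le> \<bar>L\<bar> * (norm (?z s) + norm (?z s))"
        by (intro mult_left_mono add_mono n) auto
      finally have "norm (- spray G (x s) (x' s) - (- spray G (y s) (y' s))) \<le> 2 * \<bar>L\<bar> * norm (?z s)"
        by (simp add: norm_minus_commute)
      with n(2) show "norm (x' s - y' s, - spray G (x s) (x' s) - (- spray G (y s) (y' s))) \<le> (1 + 2 * \<bar>L\<bar>) * norm (?z s)"
        by (intro order_trans[OF norm_Pair_le]) (simp add: algebra_simps)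
    qed (use d(1) that init in \<open>auto simp: dist_real_def zero_prod_def\<close>)
    then show ?thesis by (simp add: zero_prod_def)
  qed
  show ?thesis using d(1) eq by (auto simp: eventually_nhds_metric)
qed

end

section \<open>The steepest descent problem in coordinates\<close>

lemma continuous_on_Max_image:
  fixes f :: "'i \<Rightarrow> 'a::topological_space \<Rightarrow> real"
  assumes "finite I" "I \<noteq> {}" "\<And>i. i \<in> I \<Longrightarrow> continuous_on S (f i)"
  shows "continuous_on S (\<lambda>x. Max ((\<lambda>i. f i x) ` I))"
  using assms
proof (induction rule: finite_ne_induct)
  case (insert i I)
  then have "continuous_on S (\<lambda>x. max (f i x) (Max ((\<lambda>i. f i x) ` I)))"
    by (intro continuous_on_max) auto
  then show ?case using insert by simp
qed simp

text \<open>The objective is continuous, vanishes at \<open>0\<close> and is nonnegative outside a large ball, so it attains its minimum.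
Two distinct minimizers are impossible because at their midpoint the parallelogram identity makes the quadratic
term strictly smaller than the mean of its values, while the maximum of linear forms is convex.\<close>

lemma (in coordinate_metric) ex1_steepest_descent_vector:
  fixes L :: "'m::finite \<Rightarrow> 'e \<Rightarrow> real"
  assumes x: "x \<in> S" and L: "\<And>i. linear (L i)"
  shows "\<exists>!w. \<forall>u. (MAX i. L i w) + G x w w / 2 \<le> (MAX i. L i u) + G x u u / 2"
proof -
  define m where "m w = (MAX i. L i w)" for w
  define \<Phi> where "\<Phi> w = m w + G x w w / 2" for w
  have L_le: "L i w \<le> m w" for i w unfolding m_def by (rule Max_ge) auto
  have "cball x 0 \<subseteq> S" using x by simp
  then obtain l where l: "0 < l" "\<And>w. l * (norm w)\<^sup>2 \<le> G x w w"
    by (rule coercive) auto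
  obtain i0 :: 'm where True by simp
  obtain B where B: "0 < B" "\<And>w. \<bar>L i0 w\<bar> \<le> B * norm w"
    using linear_bounded_pos[OF L[of i0]] by auto
  have outside: "0 \<le> \<Phi> w" if "2 * B / l \<le> norm w" for w
  proof -
    have "B * norm w \<le> l * (norm w)\<^sup>2 / 2"
      using mult_right_mono[OF that, of "norm w"] l(1) by (simp add: field_simps power2_eq_square)
    then show ?thesis unfolding \<Phi>_def using L_le[of i0 w] B(2)[of w] l(2)[of w] by linarith
  qed
  have "continuous_on UNIV (\<lambda>w. G x w w)"
    by (rule continuous_on_compose2[OF continuous_on_G, of UNIV "\<lambda>w. (x, w)", simplified])
      (use x in \<open>auto intro!: continuous_intros\<close>)
  then have "continuous_on UNIV \<Phi>"
    unfolding \<Phi>_def m_def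
    by (intro continuous_intros continuous_on_Max_image linear_continuous_on[OF linear_conv_bounded_linear[THEN iffD1, OF L]]) auto
  then have "continuous_on (cball 0 (2 * B / l)) \<Phi>" by (rule continuous_on_subset) simp
  moreover have "0 \<le> 2 * B / l" using B(1) l(1) by simp
  then have "cball 0 (2 * B / l) \<noteq> ({} :: 'e set)" by (simp add: not_less)
  ultimately obtain w0 where w0: "\<And>u. u \<in> cball 0 (2 * B / l) \<Longrightarrow> \<Phi> w0 \<le> \<Phi> u"
    using continuous_attains_inf[OF compact_cball] by blast
  have "\<Phi> 0 = 0" using linear_0[OF L] by (simp add: \<Phi>_def m_def G_left[OF x])
  then have "\<Phi> w0 \<le> 0" using w0[of 0] B(1) l(1) by auto
  then have ex: "\<Phi> w0 \<le> \<Phi> u" for u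
    using w0[of u] outside[of u] by (cases "2 * B / l \<le> norm u") auto
  have "w = w'" if w: "\<And>u. \<Phi> w \<le> \<Phi> u" and w': "\<And>u. \<Phi> w' \<le> \<Phi> u" for w w'
  proof (rule ccontr)
    assume "w \<noteq> w'"
    define z where "z = (1/2) *\<^sub>R w + (1/2) *\<^sub>R w'"
    have "m z \<le> (m w + m w') / 2"
      unfolding m_def[of z]
    proof (rule Max.boundedI)
      fix a assume "a \<in> range (\<lambda>i. L i z)"
      then obtain i where "a = (L i w + L i w') / 2"
        by (auto simp: z_def linear_add[OF L] linear_scale[OF L] field_simps)
      then show "a \<le> (m w + m w') / 2" using L_le[of i w] L_le[of i w'] by simp
    qed auto
    moreover have "G x z z = (G x w w + G x w' w') / 2 - G x (w - w') (w - w') / 4"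
      using sym[OF x, of w w'] by (simp add: z_def G_left[OF x] G_right[OF x] field_simps)
    moreover have "0 < G x (w - w') (w - w')" using \<open>w \<noteq> w'\<close> by (intro pos[OF x]) simp
    ultimately have "\<Phi> z < (\<Phi> w + \<Phi> w') / 2" unfolding \<Phi>_def by (simp add: field_simps)
    then show False using w[of z] w'[of z] by simp
  qed
  with ex show ?thesis unfolding \<Phi>_def m_def by blast
qed

section \<open>Tangent spaces, metric and gradient in a chart\<close>

lemma scaleR_fun_apply: "(r *\<^sub>R f) x = r *\<^sub>R f x"
  by (simp add: scaleR_fun_def)

locale riemannian_manifold =
  fixes A :: "('a::{t2_space, second_countable_topology}, 'e::euclidean_space) chart set"
    and g :: "('a, 'e) metric"
  assumes atlas: "smooth_atlas A" and riemannian: "riemannian_metric A g"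
begin

abbreviation coords :: "('a, 'e) chart \<Rightarrow> 'e set" where
  "coords c \<equiv> chart_map c ` chart_dom c"

lemma obtain_chart: obtains c where "c \<in> A" "q \<in> chart_dom c"
  using atlas unfolding smooth_atlas_def by blast

context
  fixes c assumes c: "c \<in> A"
begin

lemma open_chart_dom: "open (chart_dom c)" and open_coords: "open (coords c)"
  and chart_homeomorphism: "homeomorphism (chart_dom c) (coords c) (chart_map c) (chart_inv c)"
  using atlas c unfolding smooth_atlas_def by blast+

lemmas chart_inv_map = homeomorphism_apply1[OF chart_homeomorphism]

lemma chart_inv_in_dom: "x \<in> coords c \<Longrightarrow> chart_inv c x \<in> chart_dom c"
  using chart_inv_map by auto

lemma continuous_on_chart_map: "continuous_on (chart_dom c) (chart_map c)"
  and continuous_on_chart_inv: "continuous_on (coords c) (chart_inv c)"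
  using chart_homeomorphism by (auto simp: homeomorphism_def)

lemma open_overlap: "c' \<in> A \<Longrightarrow> open (chart_map c ` (chart_dom c \<inter> chart_dom c'))"
proof -
  assume "c' \<in> A"
  then have "open (chart_dom c')" using atlas unfolding smooth_atlas_def by blast
  then have "open (coords c \<inter> chart_inv c -` chart_dom c')"
    by (rule continuous_open_preimage[OF continuous_on_chart_inv open_coords])
  moreover have "coords c \<inter> chart_inv c -` chart_dom c' = chart_map c ` (chart_dom c \<inter> chart_dom c')"
    using chart_inv_map by auto
  ultimately show ?thesis by simp
qed

lemma transition_has_derivative:
  assumes "c' \<in> A" "q \<in> chart_dom c" "q \<in> chart_dom c'"
  shows "(transition c c' has_derivative frechet_derivative (transition c c') (at (chart_map c q)))
    (at (chart_map c q))"
proof -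
  have "Ck_on 1 (chart_map c ` (chart_dom c \<inter> chart_dom c')) (transition c c')"
    using atlas c assms(1) unfolding smooth_atlas_def smooth_on_def by blast
  then show ?thesis
    using Ck_on_1D(1) assms by (metis IntI frechet_derivative_works image_eqI)
qed

text \<open>The chain rule on the overlap of two charts. Applied to real functions it makes the differential independent of
the chart; applied to a third chart map it is the cocycle rule for the transition maps.\<close>

lemma derivative_change_of_chart:
  assumes c': "c' \<in> A" and q: "q \<in> chart_dom c" "q \<in> chart_dom c'"
    and f: "(f \<circ> chart_inv c') differentiable (at (chart_map c' q))"
  shows "frechet_derivative (f \<circ> chart_inv c') (at (chart_map c' q))
      (frechet_derivative (transition c c') (at (chart_map c q)) u)
    = frechet_derivative (f \<circ> chart_inv c) (at (chart_map c q)) u"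
proof -
  let ?D = "frechet_derivative (f \<circ> chart_inv c') (at (chart_map c' q))"
  let ?T = "frechet_derivative (transition c c') (at (chart_map c q))"
  have Tq: "transition c c' (chart_map c q) = chart_map c' q"
    by (simp add: transition_def chart_inv_map[OF q(1)])
  have "((f \<circ> chart_inv c') \<circ> transition c c' has_derivative (?D \<circ> ?T)) (at (chart_map c q))"
    by (rule diff_chain_at[OF transition_has_derivative[OF c' q]])
      (use f in \<open>simp add: Tq frechet_derivative_works\<close>)
  then have "(f \<circ> chart_inv c has_derivative (?D \<circ> ?T)) (at (chart_map c q))"
  proof (rule has_derivative_transform_within_open[OF _ open_overlap[OF c']])
    fix y assume "y \<in> chart_map c ` (chart_dom c \<inter> chart_dom c')"
    then obtain r where r: "y = chart_map c r" "r \<in> chart_dom c" "r \<in> chart_dom c'" by auto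
    have "chart_inv c' (chart_map c' r) = r"
      using atlas c' r(3) unfolding smooth_atlas_def by (metis homeomorphism_apply1)
    then show "((f \<circ> chart_inv c') \<circ> transition c c') y = (f \<circ> chart_inv c) y"
      using r by (simp add: transition_def chart_inv_map)
  qed (use q in auto)
  then show ?thesis by (metis comp_apply frechet_derivative_at)
qed

end

lemma tangent_spaceI:
  assumes "\<And>c c'. c \<in> A \<Longrightarrow> c' \<in> A \<Longrightarrow> q \<in> chart_dom c \<Longrightarrow> q \<in> chart_dom c' \<Longrightarrow>
      v c' = frechet_derivative (transition c c') (at (chart_map c q)) (v c)"
    and "\<And>c. c \<notin> A \<or> q \<notin> chart_dom c \<Longrightarrow> v c = 0"
  shows "v \<in> tangent_space A q"
  using assms unfolding tangent_space_def by blast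

lemma tangent_space_coord_change:
  "v \<in> tangent_space A q \<Longrightarrow> c \<in> A \<Longrightarrow> c' \<in> A \<Longrightarrow> q \<in> chart_dom c \<Longrightarrow> q \<in> chart_dom c' \<Longrightarrow>
    v c' = frechet_derivative (transition c c') (at (chart_map c q)) (v c)"
  and tangent_space_outside: "v \<in> tangent_space A q \<Longrightarrow> c \<notin> A \<or> q \<notin> chart_dom c \<Longrightarrow> v c = 0"
  unfolding tangent_space_def by blast+

lemma linear_transition_derivative:
  "c \<in> A \<Longrightarrow> c' \<in> A \<Longrightarrow> q \<in> chart_dom c \<Longrightarrow> q \<in> chart_dom c' \<Longrightarrow>
    linear (frechet_derivative (transition c c') (at (chart_map c q)))"
  by (rule has_derivative_linear[OF transition_has_derivative])

lemma tangent_space_add: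
  assumes "u \<in> tangent_space A q" "v \<in> tangent_space A q"
  shows "u + v \<in> tangent_space A q"
proof (rule tangent_spaceI)
  fix c c' assume *: "c \<in> A" "c' \<in> A" "q \<in> chart_dom c" "q \<in> chart_dom c'"
  show "(u + v) c' = frechet_derivative (transition c c') (at (chart_map c q)) ((u + v) c)"
    using tangent_space_coord_change[OF assms(1) *] tangent_space_coord_change[OF assms(2) *]
    by (simp add: linear_add[OF linear_transition_derivative[OF *]])
qed (simp add: tangent_space_outside[OF assms(1)] tangent_space_outside[OF assms(2)])

lemma tangent_space_scaleR:
  assumes "u \<in> tangent_space A q"
  shows "r *\<^sub>R u \<in> tangent_space A q"
proof (rule tangent_spaceI)
  fix c c' assume *: "c \<in> A" "c' \<in> A" "q \<in> chart_dom c" "q \<in> chart_dom c'"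
  show "(r *\<^sub>R u) c' = frechet_derivative (transition c c') (at (chart_map c q)) ((r *\<^sub>R u) c)"
    using tangent_space_coord_change[OF assms *]
    by (simp add: linear_scale[OF linear_transition_derivative[OF *]] scaleR_fun_apply)
qed (simp add: tangent_space_outside[OF assms] scaleR_fun_apply)

text \<open>Together with \<open>coord_vector_in_tangent_space\<close> and \<open>coord_vector_self\<close> this identifies the tangent space
with the coordinate space of any chart around the point, so that tangent vectors can be replaced by their
coordinates.\<close>

lemma coord_vector_coord_vector:
  assumes c: "c \<in> A" "q \<in> chart_dom c" and v: "v \<in> tangent_space A q"
  shows "coord_vector A c q (v c) = v"
proof
  fix c'
  show "coord_vector A c q (v c) c' = v c'"
    using tangent_space_coord_change[OF v c(1) _ c(2), of c'] tangent_space_outside[OF v, of c']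
    by (cases "c' \<in> A \<and> q \<in> chart_dom c'") (auto simp: coord_vector_def)
qed

context
  fixes c q assumes c: "c \<in> A" and q: "q \<in> chart_dom c"
begin

lemma coord_vector_in_tangent_space: "coord_vector A c q u \<in> tangent_space A q"
proof -
  have "frechet_derivative (transition c1 c2) (at (chart_map c1 q))
      (frechet_derivative (transition c c1) (at (chart_map c q)) u)
    = frechet_derivative (transition c c2) (at (chart_map c q)) u"
    if "c1 \<in> A" "c2 \<in> A" "q \<in> chart_dom c1" "q \<in> chart_dom c2" for c1 c2
    using derivative_change_of_chart[OF c that(1) q that(3), of "chart_map c2" u]
      transition_has_derivative[OF that(1,2,3,4)]
    unfolding transition_def by (metis differentiableI)
  then show ?thesis by (intro tangent_spaceI) (auto simp: coord_vector_def simp del: split_paired_All)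
qed

lemma coord_vector_self: "coord_vector A c q u c = u"
proof -
  have "(transition c c has_derivative (\<lambda>u. u)) (at (chart_map c q))"
    by (rule has_derivative_transform_within_open[OF has_derivative_ident open_coords[OF c]])
      (use q chart_inv_map[OF c] in \<open>auto simp: transition_def\<close>)
  then show ?thesis using c q by (simp add: coord_vector_def frechet_derivative_at[symmetric])
qed

lemma tangent_eqI: "u \<in> tangent_space A q \<Longrightarrow> v \<in> tangent_space A q \<Longrightarrow> u c = v c \<Longrightarrow> u = v"
  using coord_vector_coord_vector[OF c q] by metis

lemma coord_vector_add: "coord_vector A c q (u + w) = coord_vector A c q u + coord_vector A c q w"
  by (rule tangent_eqI) (auto simp: coord_vector_self coord_vector_in_tangent_space tangent_space_add)

lemma coord_vector_scaleR: "coord_vector A c q (r *\<^sub>R u) = r *\<^sub>R coord_vector A c q u"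
  by (rule tangent_eqI)
    (auto simp: coord_vector_self coord_vector_in_tangent_space tangent_space_scaleR scaleR_fun_apply)

lemma metric_in_chart_map:
  "metric_in A g c (chart_map c q) u w = g q (coord_vector A c q u) (coord_vector A c q w)"
  by (simp add: metric_in_def chart_inv_map[OF c q])

lemma metric_eq_metric_in:
  "u \<in> tangent_space A q \<Longrightarrow> v \<in> tangent_space A q \<Longrightarrow>
    g q u v = metric_in A g c (chart_map c q) (u c) (v c)"
  by (simp add: metric_in_chart_map coord_vector_coord_vector[OF c q])

end

lemma metric_sym: "u \<in> tangent_space A q \<Longrightarrow> v \<in> tangent_space A q \<Longrightarrow> g q u v = g q v u"
  and metric_add: "u \<in> tangent_space A q \<Longrightarrow> v \<in> tangent_space A q \<Longrightarrow> w \<in> tangent_space A q \<Longrightarrow>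
    g q (u + v) w = g q u w + g q v w"
  and metric_scaleR: "u \<in> tangent_space A q \<Longrightarrow> v \<in> tangent_space A q \<Longrightarrow> g q (r *\<^sub>R u) v = r * g q u v"
  and metric_pos: "u \<in> tangent_space A q \<Longrightarrow> u \<noteq> 0 \<Longrightarrow> 0 < g q u u"
  and metric_smooth: "c \<in> A \<Longrightarrow> smooth_on (coords c) (\<lambda>x. metric_in A g c x e e')"
  using riemannian unfolding riemannian_metric_def by blast+

text \<open>The gateway from the manifold to the coordinate estimates: in each chart the metric is a field of inner products
of the kind studied above.\<close>

lemma coordinate_metric_chart:
  assumes c: "c \<in> A"
  shows "coordinate_metric (coords c) (metric_in A g c)"
proof (rule coordinate_metric.intro)
  show "open (coords c)" by (rule open_coords[OF c])
  show "Ck_on 2 (coords c) (\<lambda>x. metric_in A g c x u w)" for u w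
    using metric_smooth[OF c] by (simp add: smooth_on_def)
  fix x assume "x \<in> coords c"
  then obtain q where q: "q \<in> chart_dom c" "x = chart_map c q" by auto
  note cq = c q(1)
  note [simp] = metric_in_chart_map[OF cq] coord_vector_in_tangent_space[OF cq] q(2)
  show "linear (\<lambda>u. metric_in A g c x u w)" for w
    by (rule linearI) (simp_all add: coord_vector_add[OF cq] coord_vector_scaleR[OF cq] metric_add metric_scaleR)
  show "metric_in A g c x u w = metric_in A g c x w u" for u w
    by (simp add: metric_sym)
  have "coord_vector A c q u \<noteq> 0" if "u \<noteq> 0" for u
    using coord_vector_self[OF cq, of u] that by auto
  then show "0 < metric_in A g c x u u" if "u \<noteq> 0" for u
    using that by (simp add: metric_pos)
qed

definition differential :: "('a \<Rightarrow> real) \<Rightarrow> ('a, 'e) chart \<Rightarrow> 'e \<Rightarrow> 'e \<Rightarrow> real" where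
  "differential f c x = frechet_derivative (f \<circ> chart_inv c) (at x)"

lemma has_derivative_differential:
  assumes "continuously_differentiable A f" "c \<in> A" "x \<in> coords c"
  shows "((f \<circ> chart_inv c) has_derivative differential f c x) (at x)"
  using assms Ck_on_1D(1)[of "coords c" "f \<circ> chart_inv c" x]
  unfolding continuously_differentiable_def differential_def
  by (simp add: frechet_derivative_works)

lemma linear_differential:
  assumes "continuously_differentiable A f" "c \<in> A" "x \<in> coords c"
  shows "linear (differential f c x)"
  using has_derivative_differential[OF assms] by (rule has_derivative_linear)

text \<open>The Riesz representation in one chart provides the gradient, and \<open>derivative_change_of_chart\<close> shows that the same
vector represents the differential in every other chart.\<close>

lemma metric_riemannian_grad:
  assumes f: "continuously_differentiable A f" and v: "v \<in> tangent_space A q"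
    and c: "c \<in> A" "q \<in> chart_dom c"
  shows "g q (riemannian_grad A g f q) v = differential f c (chart_map c q) (v c)"
proof -
  interpret coordinate_metric "coords c" "metric_in A g c" by (rule coordinate_metric_chart[OF c(1)])
  let ?x = "chart_map c q"
  have x: "?x \<in> coords c" using c by simp
  define P where "P u \<longleftrightarrow> u \<in> tangent_space A q \<and> (\<forall>v\<in>tangent_space A q. \<forall>c\<in>A. q \<in> chart_dom c \<longrightarrow>
    g q u v = frechet_derivative (f \<circ> chart_inv c) (at (chart_map c q)) (v c))" for u
  obtain y where y: "\<And>z. metric_in A g c ?x y z = differential f c ?x z"
    using riesz_representation[OF x linear_differential[OF f c(1) x]] by blast
  have P: "P (coord_vector A c q y)"
    unfolding P_def
  proof (intro conjI ballI impI)
    show "coord_vector A c q y \<in> tangent_space A q" by (rule coord_vector_in_tangent_space[OF c])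
    fix v c' assume v: "v \<in> tangent_space A q" and c': "c' \<in> A" "q \<in> chart_dom c'"
    have "g q (coord_vector A c q y) v = differential f c ?x (v c)"
      using metric_eq_metric_in[OF c coord_vector_in_tangent_space[OF c] v] y
      by (simp add: coord_vector_self[OF c])
    also have "\<dots> = frechet_derivative (f \<circ> chart_inv c') (at (chart_map c' q)) (v c')"
      using derivative_change_of_chart[OF c(1) c'(1) c(2) c'(2), of f "v c"]
        has_derivative_differential[OF f c'(1), of "chart_map c' q"]
        tangent_space_coord_change[OF v c(1) c'(1) c(2) c'(2)] c'(2)
      by (simp add: differential_def differentiableI)
    finally show "g q (coord_vector A c q y) v
      = frechet_derivative (f \<circ> chart_inv c') (at (chart_map c' q)) (v c')" .
  qed
  have "u = coord_vector A c q y" if "P u" for u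
  proof (rule tangent_eqI[OF c])
    show u: "u \<in> tangent_space A q" using that by (simp add: P_def)
    show "coord_vector A c q y \<in> tangent_space A q" by (rule coord_vector_in_tangent_space[OF c])
    have "metric_in A g c ?x (u c) z = metric_in A g c ?x y z" for z
    proof -
      have "metric_in A g c ?x (u c) z = g q u (coord_vector A c q z)"
        using metric_eq_metric_in[OF c u coord_vector_in_tangent_space[OF c]]
        by (simp add: coord_vector_self[OF c])
      also have "\<dots> = differential f c ?x z"
        using that c coord_vector_in_tangent_space[OF c, of z] unfolding P_def differential_def
        by (metis coord_vector_self[OF c])
      finally show ?thesis using y by simp
    qed
    then show "u c = coord_vector A c q y c"
      unfolding coord_vector_self[OF c] by (intro nondegenerate[OF x]) auto
  qed
  with P have "P (THE u. P u)" by (metis theI)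
  then show ?thesis
    using v c unfolding P_def differential_def riemannian_grad_def by simp
qed

end

lemma Ck_on_1_component:
  assumes "Ck_on 1 S f"
  shows "Ck_on 1 S (\<lambda>x. f x $ i)"
proof -
  have der: "((\<lambda>x. f x $ i) has_derivative (\<lambda>v. frechet_derivative f (at x) v $ i)) (at x)" if "x \<in> S" for x
    by (rule bounded_linear.has_derivative[OF bounded_linear_vec_nth])
      (use Ck_on_1D(1)[OF assms that] in \<open>simp add: frechet_derivative_works\<close>)
  have "continuous_on S (\<lambda>x. frechet_derivative (\<lambda>x. f x $ i) (at x) v)" for v
    by (rule continuous_on_eq[OF continuous_on_component[OF Ck_on_1D(2)[OF assms, of v], of i]])
      (use frechet_derivative_at[OF der] in \<open>simp add: fun_eq_iff\<close>)
  then show ?thesis using der by (auto simp: One_nat_def differentiable_def)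
qed

context riemannian_manifold
begin

lemma continuously_differentiable_component:
  "continuously_differentiable A F \<Longrightarrow> continuously_differentiable A (\<lambda>q. F q $ i)"
  unfolding continuously_differentiable_def comp_def by (intro ballI Ck_on_1_component) (rule bspec)

lemma isCont_continuously_differentiable:
  assumes "continuously_differentiable A f"
  shows "isCont f q"
proof -
  obtain c where c: "c \<in> A" "q \<in> chart_dom c" by (rule obtain_chart)
  have "continuous_on (coords c) (f \<circ> chart_inv c)"
    using assms c Ck_on_1_imp_continuous_on unfolding continuously_differentiable_def by blast
  then have "continuous_on (chart_dom c) ((f \<circ> chart_inv c) \<circ> chart_map c)"
    by (rule continuous_on_compose[OF continuous_on_chart_map[OF c(1)]])
  then have "continuous_on (chart_dom c) f"
    by (rule continuous_on_eq) (simp add: chart_inv_map[OF c(1)])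
  then show ?thesis using c open_chart_dom continuous_on_eq_continuous_at by blast
qed

context
  fixes F :: "'a \<Rightarrow> real^'m" assumes F: "continuously_differentiable A F"
begin

lemma grad_apply_component:
  "v \<in> tangent_space A q \<Longrightarrow> c \<in> A \<Longrightarrow> q \<in> chart_dom c \<Longrightarrow>
    grad_apply A g F q v $ i = differential (\<lambda>q. F q $ i) c (chart_map c q) (v c)"
  by (simp add: grad_apply_def metric_riemannian_grad[OF continuously_differentiable_component[OF F]])

lemma not_pareto_critical_iff:
  assumes c: "c \<in> A" "q \<in> chart_dom c"
  shows "\<not> pareto_critical A g F q \<longleftrightarrow>
    (\<exists>u. \<forall>i. differential (\<lambda>q. F q $ i) c (chart_map c q) u < 0)"
proof
  assume "\<not> pareto_critical A g F q"
  then obtain v y where v: "v \<in> tangent_space A q" "grad_apply A g F q v = - y" "\<And>i. 0 < y $ i"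
    unfolding pareto_critical_def by auto
  then have "differential (\<lambda>q. F q $ i) c (chart_map c q) (v c) < 0" for i
  proof -
    have "differential (\<lambda>q. F q $ i) c (chart_map c q) (v c) = - (y $ i)"
      using grad_apply_component[OF v(1) c, of i] v(2) by simp
    then show ?thesis using v(3)[of i] by linarith
  qed
  then show "\<exists>u. \<forall>i. differential (\<lambda>q. F q $ i) c (chart_map c q) u < 0" by blast
next
  assume "\<exists>u. \<forall>i. differential (\<lambda>q. F q $ i) c (chart_map c q) u < 0"
  then obtain u where u: "\<And>i. differential (\<lambda>q. F q $ i) c (chart_map c q) u < 0" by blast
  let ?v = "coord_vector A c q u"
  have v: "?v \<in> tangent_space A q" by (rule coord_vector_in_tangent_space[OF c])
  have "grad_apply A g F q ?v $ i < 0" for i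
    using grad_apply_component[OF v c] u by (simp add: coord_vector_self[OF c])
  then have "grad_apply A g F q ?v \<in> uminus ` {x. \<forall>i. x $ i > 0}"
    by (intro image_eqI[of _ _ "- grad_apply A g F q ?v"]) auto
  with v show "\<not> pareto_critical A g F q" unfolding pareto_critical_def by blast
qed

text \<open>The coordinate map carries the minimization over the tangent space to the one over the coordinate space, where
the minimizer exists and is unique.\<close>

lemma steepest_descent_direction:
  assumes c: "c \<in> A" "q \<in> chart_dom c"
  defines "v \<equiv> steepest_descent_direction A g F q"
  shows "v \<in> tangent_space A q"
    and "(MAX i. differential (\<lambda>q. F q $ i) c (chart_map c q) (v c))
        + metric_in A g c (chart_map c q) (v c) (v c) / 2
      \<le> (MAX i. differential (\<lambda>q. F q $ i) c (chart_map c q) u)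
        + metric_in A g c (chart_map c q) u u / 2"
proof -
  interpret coordinate_metric "coords c" "metric_in A g c" by (rule coordinate_metric_chart[OF c(1)])
  let ?x = "chart_map c q"
  have x: "?x \<in> coords c" using c by simp
  define L where "L i = differential (\<lambda>q. F q $ i) c ?x" for i
  define \<Phi> where "\<Phi> u = (MAX i. L i u) + metric_in A g c ?x u u / 2" for u
  define \<Psi> where "\<Psi> v = (MAX i. grad_apply A g F q v $ i) + (riemannian_norm g q v)\<^sup>2 / 2" for v
  have eq: "\<Psi> v = \<Phi> (v c)" if v: "v \<in> tangent_space A q" for v
  proof -
    have "0 \<le> g q v v"
      unfolding metric_eq_metric_in[OF c v v] using pos[OF x, of "v c"] G_left(4)[OF x]
      by (cases "v c = 0") auto
    then show ?thesis
      by (simp add: \<Psi>_def \<Phi>_def L_def riemannian_norm_def grad_apply_component[OF v c]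
          metric_eq_metric_in[OF c v v])
  qed
  have iff: "is_arg_min \<Psi> (\<lambda>v. v \<in> tangent_space A q) v \<longleftrightarrow> v \<in> tangent_space A q \<and> (\<forall>u. \<Phi> (v c) \<le> \<Phi> u)"
    for v
  proof -
    have "\<Phi> u = \<Psi> (coord_vector A c q u)" for u
      using eq[OF coord_vector_in_tangent_space[OF c]] by (simp add: coord_vector_self[OF c])
    then show ?thesis
      unfolding is_arg_min_linorder using eq coord_vector_in_tangent_space[OF c] by metis
  qed
  have "\<exists>!w. \<forall>u. \<Phi> w \<le> \<Phi> u"
    unfolding \<Phi>_def L_def
    by (rule ex1_steepest_descent_vector[OF x linear_differential[OF continuously_differentiable_component[OF F] c(1) x]])
  then obtain w where w: "\<And>u. \<Phi> w \<le> \<Phi> u" and uniq: "\<And>w'. \<forall>u. \<Phi> w' \<le> \<Phi> u \<Longrightarrow> w' = w" by metis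
  have "is_arg_min \<Psi> (\<lambda>v. v \<in> tangent_space A q) (coord_vector A c q w)"
    unfolding iff using w coord_vector_in_tangent_space[OF c] by (simp add: coord_vector_self[OF c])
  moreover have "v' = coord_vector A c q w" if "is_arg_min \<Psi> (\<lambda>v. v \<in> tangent_space A q) v'" for v'
    using that uniq coord_vector_coord_vector[OF c, of v'] unfolding iff by metis
  ultimately have "is_arg_min \<Psi> (\<lambda>v. v \<in> tangent_space A q) v"
    unfolding v_def steepest_descent_direction_def \<Psi>_def by (metis (no_types, lifting) theI)
  then have "v \<in> tangent_space A q" "\<Phi> (v c) \<le> \<Phi> u" unfolding iff by auto
  then show "v \<in> tangent_space A q"
    and "(MAX i. differential (\<lambda>q. F q $ i) c ?x (v c)) + metric_in A g c ?x (v c) (v c) / 2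
      \<le> (MAX i. differential (\<lambda>q. F q $ i) c ?x u) + metric_in A g c ?x u u / 2"
    unfolding \<Phi>_def L_def by auto
qed

end

section \<open>Geodesics and the exponential map\<close>

lemma geodesic_continuous_on: "geodesic A g \<gamma> \<Longrightarrow> continuous_on UNIV \<gamma>"
  unfolding geodesic_def by (rule conjunct1)

lemma geodesic_in_chart:
  assumes "geodesic A g \<gamma>" "c \<in> A" "\<gamma> t \<in> chart_dom c"
  shows "((chart_map c \<circ> \<gamma>) has_vector_derivative velocity A \<gamma> t c) (at t)"
    and "((\<lambda>t. velocity A \<gamma> t c) has_vector_derivative
      - spray (metric_in A g c) (chart_map c (\<gamma> t)) (velocity A \<gamma> t c)) (at t)"
proof -
  have vel: "velocity A \<gamma> s c = vector_derivative (chart_map c \<circ> \<gamma>) (at s)" if "\<gamma> s \<in> chart_dom c" for s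
    using that assms(2) by (simp add: velocity_def)
  have "(chart_map c \<circ> \<gamma>) differentiable (at t)"
    and 2: "((\<lambda>s. vector_derivative (chart_map c \<circ> \<gamma>) (at s)) has_vector_derivative
      - spray (metric_in A g c) (chart_map c (\<gamma> t)) (velocity A \<gamma> t c)) (at t)"
    using assms vel[of t] unfolding geodesic_def by (auto simp: Let_def christoffel_diagonal)
  then show "((chart_map c \<circ> \<gamma>) has_vector_derivative velocity A \<gamma> t c) (at t)"
    using vel[OF assms(3)] by (simp add: vector_derivative_works)
  have "open (\<gamma> -` chart_dom c)"
    by (rule open_vimage[OF open_chart_dom[OF assms(2)] geodesic_continuous_on[OF assms(1)]])
  with 2 show "((\<lambda>t. velocity A \<gamma> t c) has_vector_derivative
      - spray (metric_in A g c) (chart_map c (\<gamma> t)) (velocity A \<gamma> t c)) (at t)"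
    by (rule has_vector_derivative_transform_within_open) (use assms(3) vel in auto)
qed

lemma geodesic_isCont: "geodesic A g \<gamma> \<Longrightarrow> isCont \<gamma> t"
  by (rule continuous_on_interior[OF geodesic_continuous_on]) (assumption, simp)

lemma geodesic_eventually_in_chart:
  assumes "geodesic A g \<gamma>" "c \<in> A" "\<gamma> t \<in> chart_dom c"
  shows "\<forall>\<^sub>F s in nhds t. \<gamma> s \<in> chart_dom c"
proof -
  have "open (\<gamma> -` chart_dom c)"
    by (rule open_vimage[OF open_chart_dom[OF assms(2)] geodesic_continuous_on[OF assms(1)]])
  from eventually_nhds_in_open[OF this, of t] assms(3) show ?thesis by simp
qed

text \<open>The times at which two geodesics agree together with their velocities form a closed set, since the space is
Hausdorff and velocities are continuous in a chart, and an open set by local uniqueness in a chart. The real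
line is connected.\<close>

lemma geodesic_unique:
  assumes \<gamma>: "geodesic A g \<gamma>" and \<delta>: "geodesic A g \<delta>"
    and init: "\<gamma> 0 = \<delta> 0" "velocity A \<gamma> 0 = velocity A \<delta> 0"
  shows "\<gamma> = \<delta>"
proof -
  define E where "E = {t. \<gamma> t = \<delta> t \<and> velocity A \<gamma> t = velocity A \<delta> t}"
  have "open E"
  proof (subst open_subopen, intro ballI)
    fix t0 assume t0: "t0 \<in> E"
    obtain c where c: "c \<in> A" "\<gamma> t0 \<in> chart_dom c" by (rule obtain_chart)
    interpret coordinate_metric "coords c" "metric_in A g c" by (rule coordinate_metric_chart[OF c(1)])
    have "\<forall>\<^sub>F s in nhds t0. \<gamma> s \<in> chart_dom c \<and> \<delta> s \<in> chart_dom c"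
      using geodesic_eventually_in_chart[OF \<gamma> c] geodesic_eventually_in_chart[OF \<delta> c(1)] c(2) t0
      by (simp add: E_def eventually_conj)
    then obtain d where d: "d > 0" "\<And>s. dist s t0 < d \<Longrightarrow> \<gamma> s \<in> chart_dom c \<and> \<delta> s \<in> chart_dom c"
      by (auto simp: eventually_nhds_metric)
    have "\<forall>\<^sub>F s in nhds t0. (chart_map c \<circ> \<gamma>) s = (chart_map c \<circ> \<delta>) s"
    proof (rule spray_ode_unique[where a = "t0 - d" and b = "t0 + d"
          and x' = "\<lambda>t. velocity A \<gamma> t c" and y' = "\<lambda>t. velocity A \<delta> t c"])
      fix s assume "s \<in> {t0 - d<..<t0 + d}"
      then have "dist s t0 < d" by (auto simp: dist_real_def)
      note ds = d(2)[OF this]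
      show "(chart_map c \<circ> \<gamma>) s \<in> coords c \<and>
          ((chart_map c \<circ> \<gamma>) has_vector_derivative velocity A \<gamma> s c) (at s) \<and>
          ((\<lambda>t. velocity A \<gamma> t c) has_vector_derivative
            - spray (metric_in A g c) ((chart_map c \<circ> \<gamma>) s) (velocity A \<gamma> s c)) (at s)"
        using geodesic_in_chart[OF \<gamma> c(1)] ds by simp
      show "(chart_map c \<circ> \<delta>) s \<in> coords c \<and>
          ((chart_map c \<circ> \<delta>) has_vector_derivative velocity A \<delta> s c) (at s) \<and>
          ((\<lambda>t. velocity A \<delta> t c) has_vector_derivative
            - spray (metric_in A g c) ((chart_map c \<circ> \<delta>) s) (velocity A \<delta> s c)) (at s)"
        using geodesic_in_chart[OF \<delta> c(1)] ds by simp
    qed (use t0 d(1) in \<open>auto simp: E_def\<close>)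
    with \<open>\<forall>\<^sub>F s in nhds t0. \<gamma> s \<in> chart_dom c \<and> \<delta> s \<in> chart_dom c\<close>
    have "\<forall>\<^sub>F s in nhds t0. \<gamma> s = \<delta> s"
      by eventually_elim (metis chart_inv_map[OF c(1)] comp_apply)
    then obtain U where U: "open U" "t0 \<in> U" "\<And>s. s \<in> U \<Longrightarrow> \<gamma> s = \<delta> s"
      by (auto simp: eventually_nhds)
    have "velocity A \<gamma> s = velocity A \<delta> s" if s: "s \<in> U" for s
    proof
      fix c' :: "('a, 'e) chart"
      have "vector_derivative (chart_map c' \<circ> \<gamma>) (at s) = vector_derivative (chart_map c' \<circ> \<delta>) (at s)"
        by (rule vector_derivative_cong_eq)
          (use U s in \<open>auto simp: eventually_nhds\<close>)
      then show "velocity A \<gamma> s c' = velocity A \<delta> s c'" using U(3)[OF s] by (simp add: velocity_def)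
    qed
    then show "\<exists>T. open T \<and> t0 \<in> T \<and> T \<subseteq> E" using U by (auto simp: E_def)
  qed
  moreover have "closed E"
    unfolding closed_sequential_limits
  proof (intro allI impI)
    fix s t0 assume st: "(\<forall>n. s n \<in> E) \<and> s \<longlonglongrightarrow> t0"
    have lim: "(\<lambda>n. f (s n)) \<longlonglongrightarrow> f t0" if "isCont f t0" for f :: "real \<Rightarrow> 'z::topological_space"
      by (rule isCont_tendsto_compose[OF that]) (use st in blast)
    have eqE: "\<gamma> (s n) = \<delta> (s n)" "velocity A \<gamma> (s n) = velocity A \<delta> (s n)" for n
      using st by (auto simp: E_def)
    have 1: "\<gamma> t0 = \<delta> t0"
      using lim[OF geodesic_isCont[OF \<gamma>]] lim[OF geodesic_isCont[OF \<delta>]]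
      unfolding eqE(1) by (rule LIMSEQ_unique)
    have "velocity A \<gamma> t0 c = velocity A \<delta> t0 c" for c
    proof (cases "c \<in> A \<and> \<gamma> t0 \<in> chart_dom c")
      case True
      then have "isCont (\<lambda>t. velocity A \<gamma> t c) t0" "isCont (\<lambda>t. velocity A \<delta> t c) t0"
        using has_vector_derivative_continuous[OF geodesic_in_chart(2)[OF \<gamma>, of c t0]]
          has_vector_derivative_continuous[OF geodesic_in_chart(2)[OF \<delta>, of c t0]] 1
        by simp_all
      from lim[OF this(1)] lim[OF this(2)] show ?thesis
        unfolding eqE(2) by (rule LIMSEQ_unique)
    next
      case False
      then show ?thesis using 1 by (auto simp: velocity_def)
    qed
    with 1 show "t0 \<in> E" by (auto simp: E_def)
  qed
  moreover have "0 \<in> E" using init by (simp add: E_def)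
  ultimately have "E = UNIV" using clopen by blast
  then show ?thesis by (auto simp: E_def)
qed

lemma geodesic_rescale:
  assumes \<gamma>: "geodesic A g \<gamma>"
  shows "geodesic A g (\<lambda>s. \<gamma> (r * s))" and "velocity A (\<lambda>s. \<gamma> (r * s)) 0 = r *\<^sub>R velocity A \<gamma> 0"
proof -
  let ?\<delta> = "\<lambda>s. \<gamma> (r * s)"
  have der: "((chart_map c \<circ> ?\<delta>) has_vector_derivative r *\<^sub>R velocity A \<gamma> (r * s) c) (at s)"
    if "c \<in> A" "\<gamma> (r * s) \<in> chart_dom c" for c s
  proof -
    have "((*) r has_vector_derivative r) (at s)"
      by (auto intro!: derivative_eq_intros simp: has_real_derivative_iff_has_vector_derivative[symmetric])
    from vector_diff_chain_at[OF this geodesic_in_chart(1)[OF \<gamma> that]]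
    show ?thesis by (simp add: comp_def)
  qed
  show "velocity A ?\<delta> 0 = r *\<^sub>R velocity A \<gamma> 0"
  proof
    fix c
    show "velocity A ?\<delta> 0 c = (r *\<^sub>R velocity A \<gamma> 0) c"
    proof (cases "c \<in> A \<and> \<gamma> 0 \<in> chart_dom c")
      case True
      then have "vector_derivative (chart_map c \<circ> ?\<delta>) (at 0) = r *\<^sub>R velocity A \<gamma> 0 c"
        using vector_derivative_at[OF der[of c 0]] by simp
      with True show ?thesis by (simp add: velocity_def[of A ?\<delta>] scaleR_fun_apply)
    next
      case False
      then show ?thesis by (auto simp: velocity_def scaleR_fun_apply)
    qed
  qed
  have cont: "continuous_on UNIV ?\<delta>"
    by (intro continuous_on_compose2[OF geodesic_continuous_on[OF \<gamma>]] continuous_intros) auto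
  show "geodesic A g ?\<delta>"
    unfolding geodesic_def Let_def
  proof (intro conjI ballI allI impI cont)
    fix c t assume c: "c \<in> A" and t: "?\<delta> t \<in> chart_dom c"
    interpret coordinate_metric "coords c" "metric_in A g c" by (rule coordinate_metric_chart[OF c])
    have op: "open (?\<delta> -` chart_dom c)"
      using open_vimage[OF open_chart_dom[OF c] cont] .
    have vel: "vector_derivative (chart_map c \<circ> ?\<delta>) (at s) = r *\<^sub>R velocity A \<gamma> (r * s) c"
      if "?\<delta> s \<in> chart_dom c" for s
      by (rule vector_derivative_at[OF der[OF c that]])
    show "(chart_map c \<circ> ?\<delta>) differentiable (at t)"
      using der[OF c t] by (auto simp: differentiable_def has_vector_derivative_def)
    have "((*) r has_vector_derivative r) (at t)"
      by (auto intro!: derivative_eq_intros simp: has_real_derivative_iff_has_vector_derivative[symmetric])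
    from bounded_linear.has_vector_derivative[OF bounded_linear_scaleR_right[of r]
        vector_diff_chain_at[OF this geodesic_in_chart(2)[OF \<gamma> c t]]]
    have "((\<lambda>s. r *\<^sub>R velocity A \<gamma> (r * s) c) has_vector_derivative
        r *\<^sub>R r *\<^sub>R - spray (metric_in A g c) (chart_map c (\<gamma> (r * t))) (velocity A \<gamma> (r * t) c)) (at t)"
      by (simp add: comp_def)
    moreover have "chart_map c (\<gamma> (r * t)) \<in> coords c" using t by simp
    ultimately have "((\<lambda>s. r *\<^sub>R velocity A \<gamma> (r * s) c) has_vector_derivative
        - christoffel A g c ((chart_map c \<circ> ?\<delta>) t) (vector_derivative (chart_map c \<circ> ?\<delta>) (at t))
          (vector_derivative (chart_map c \<circ> ?\<delta>) (at t))) (at t)"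
      unfolding christoffel_diagonal vel[OF t] by (simp add: spray_scaleR power2_eq_square)
    then show "((\<lambda>s. vector_derivative (chart_map c \<circ> ?\<delta>) (at s)) has_vector_derivative
        - christoffel A g c ((chart_map c \<circ> ?\<delta>) t) (vector_derivative (chart_map c \<circ> ?\<delta>) (at t))
          (vector_derivative (chart_map c \<circ> ?\<delta>) (at t))) (at t)"
      by (rule has_vector_derivative_transform_within_open[OF _ op]) (use t vel in auto)
  qed
qed

text \<open>The geodesic with initial velocity \<open>t \<cdot> v\<close>, followed up to time \<open>1\<close>, is the geodesic with initial velocity \<open>v\<close>
followed up to time \<open>t\<close>.\<close>

lemma riemannian_exp_geodesic:
  assumes \<gamma>: "geodesic A g \<gamma>"
  shows "riemannian_exp A g (\<gamma> 0) (t *\<^sub>R velocity A \<gamma> 0) = \<gamma> t"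
  unfolding riemannian_exp_def
proof (rule the_equality)
  show "\<exists>\<delta>. geodesic A g \<delta> \<and> \<delta> 0 = \<gamma> 0 \<and> velocity A \<delta> 0 = t *\<^sub>R velocity A \<gamma> 0 \<and> \<delta> 1 = \<gamma> t"
    using geodesic_rescale[OF \<gamma>, of t] by (intro exI[of _ "\<lambda>s. \<gamma> (t * s)"]) simp
  fix q assume "\<exists>\<delta>. geodesic A g \<delta> \<and> \<delta> 0 = \<gamma> 0 \<and> velocity A \<delta> 0 = t *\<^sub>R velocity A \<gamma> 0 \<and> \<delta> 1 = q"
  then obtain \<delta> where \<delta>: "geodesic A g \<delta>" "\<delta> 0 = \<gamma> 0" "velocity A \<delta> 0 = t *\<^sub>R velocity A \<gamma> 0" "\<delta> 1 = q"
    by blast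
  have "\<delta> = (\<lambda>s. \<gamma> (t * s))"
    by (rule geodesic_unique[OF \<delta>(1) geodesic_rescale(1)[OF \<gamma>]]) (use \<delta> geodesic_rescale(2)[OF \<gamma>] in auto)
  then show "q = \<gamma> t" using \<delta>(4) by auto
qed

end

section \<open>Uniform Armijo steps near a noncritical point\<close>

lemma eventually_nhds_less:
  fixes h :: "'a::t2_space \<Rightarrow> real"
  assumes "isCont h x" "h x < a"
  shows "\<forall>\<^sub>F y in nhds x. h y < a"
  by (rule order_tendstoD(2)[of h "h x"])
    (use assms in \<open>simp_all only: isCont_def tendsto_at_iff_tendsto_nhds\<close>)

context riemannian_manifold
begin

text \<open>The time \<open>T\<close> depends only on the chart, the ball, the speed bound \<open>R\<close> and the tolerance \<open>e\<close>, not on the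
geodesic. While the geodesic is in the ball with speed at most \<open>R + 2 e\<close>, its acceleration is at
most \<open>C (R + 2 e)\<^sup>2\<close>, so for \<open>t \<le> T\<close> the velocity has changed by at most \<open>e\<close> and the point has moved by less
than \<open>r / 2\<close>. This improves the bounds that were assumed and \<open>bootstrap_on_interval\<close> applies.\<close>

lemma geodesic_stays_near:
  assumes c: "c \<in> A" and sub: "cball x0 r \<subseteq> coords c" and params: "0 < r" "0 \<le> R" "0 < e"
  obtains T where "0 < T"
    "\<And>\<gamma> t. geodesic A g \<gamma> \<Longrightarrow> \<gamma> 0 \<in> chart_dom c \<Longrightarrow> chart_map c (\<gamma> 0) \<in> cball x0 (r / 2) \<Longrightarrow>
      norm (velocity A \<gamma> 0 c) \<le> R \<Longrightarrow> 0 \<le> t \<Longrightarrow> t \<le> T \<Longrightarrow>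
      \<gamma> t \<in> chart_dom c \<and> chart_map c (\<gamma> t) \<in> cball x0 r \<and>
      norm (velocity A \<gamma> t c - velocity A \<gamma> 0 c) \<le> e"
proof -
  interpret coordinate_metric "coords c" "metric_in A g c" by (rule coordinate_metric_chart[OF c])
  obtain C where C: "0 < C"
    "\<And>x u. x \<in> cball x0 r \<Longrightarrow> norm (spray (metric_in A g c) x u) \<le> C * (norm u)\<^sup>2"
    using spray_bound[OF sub] by blast
  define V where "V = R + 2 * e"
  have V: "0 < V" using params by (simp add: V_def)
  define T where "T = min (e / (C * V\<^sup>2)) (r / (4 * V))"
  have T: "0 < T" using params V C(1) by (simp add: T_def)
  have TC: "T * (C * V\<^sup>2) \<le> e"
    using mult_right_mono[of T "e / (C * V\<^sup>2)" "C * V\<^sup>2"] C(1) V by (simp add: T_def)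
  have "T * V \<le> r / 4"
    using mult_right_mono[of T "r / (4 * V)" V] V by (simp add: T_def)
  then have TV: "T * V < r / 2" using params by simp
  show ?thesis
  proof (rule that[OF T])
    fix \<gamma> t
    assume \<gamma>: "geodesic A g \<gamma>" and start: "\<gamma> 0 \<in> chart_dom c" "chart_map c (\<gamma> 0) \<in> cball x0 (r / 2)"
      and vel0: "norm (velocity A \<gamma> 0 c) \<le> R" and t: "0 \<le> t" "t \<le> T"
    define x where "x = chart_map c \<circ> \<gamma>"
    define v where "v s = velocity A \<gamma> s c" for s
    define P where "P s \<longleftrightarrow> \<gamma> s \<in> chart_dom c \<and> x s \<in> ball x0 r \<and> norm (v s - v 0) < 2 * e" for s
    define Q where "Q s \<longleftrightarrow> \<gamma> s \<in> chart_dom c \<and> x s \<in> ball x0 r \<and> norm (v s - v 0) \<le> e" for s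
    have dx: "(x has_vector_derivative v s) (at s)"
      and dv: "(v has_vector_derivative - spray (metric_in A g c) (x s) (v s)) (at s)"
      if "\<gamma> s \<in> chart_dom c" for s
      using geodesic_in_chart[OF \<gamma> c that] by (simp_all add: x_def v_def[abs_def])
    have "Q t"
    proof (rule bootstrap_on_interval[where P = P and T = T, OF _ _ t])
      fix s assume s: "0 \<le> s" "s \<le> T" and Q: "Q s"
      then have s_dom: "\<gamma> s \<in> chart_dom c" by (simp add: Q_def)
      have cont: "isCont x s" "isCont v s"
        using has_vector_derivative_continuous[OF dx[OF s_dom]] has_vector_derivative_continuous[OF dv[OF s_dom]] by auto
      have "\<forall>\<^sub>F u in nhds s. dist x0 (x u) < r"
        using Q cont(1) by (intro eventually_nhds_less continuous_intros) (auto simp: Q_def)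
      moreover have "\<forall>\<^sub>F u in nhds s. norm (v u - v 0) < 2 * e"
        using Q params(3) cont(2) by (intro eventually_nhds_less continuous_intros) (auto simp: Q_def)
      ultimately show "\<forall>\<^sub>F u in nhds s. P u"
        using geodesic_eventually_in_chart[OF \<gamma> c s_dom] unfolding P_def mem_ball
        by (intro eventually_conj)
    next
      fix s assume s: "0 \<le> s" "s \<le> T" and P: "\<And>u. 0 \<le> u \<Longrightarrow> u < s \<Longrightarrow> P u"
      show "Q s"
      proof (cases "s = 0")
        case True
        then show ?thesis using start params by (auto simp: Q_def x_def)
      next
        case False
        then have s0: "0 < s" using s by simp
        have V_bound: "norm (v u) \<le> V" if "0 \<le> u" "u < s" for u
          using P[OF that] vel0 norm_triangle_sub[of "v u" "v 0"] unfolding P_def V_def v_def[of 0] by linarith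
        \<comment> \<open>The geodesic cannot leave the chart at time \<open>s\<close>: the closed coordinate ball is compact,
            hence closed in the manifold.\<close>
        let ?K = "chart_inv c ` cball x0 r"
        have "closed ?K"
          by (intro compact_imp_closed compact_continuous_image compact_cball
              continuous_on_subset[OF continuous_on_chart_inv[OF c] sub])
        moreover have "\<gamma> u \<in> ?K" if "u \<in> {0..<s}" for u
          using P[of u] that chart_inv_map[OF c, of "\<gamma> u"]
          by (intro image_eqI[of _ _ "x u"]) (auto simp: P_def x_def)
        moreover have "s \<in> closure {0..<s}" using s0 by simp
        ultimately have "\<gamma> s \<in> ?K"
          using image_closure_subset[OF continuous_on_subset[OF geodesic_continuous_on[OF \<gamma>]], of "{0..<s}" ?K]
          by blast
        then have s_dom: "\<gamma> s \<in> chart_dom c" using chart_inv_in_dom[OF c] sub by auto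
        then have dom: "\<gamma> u \<in> chart_dom c" if "0 \<le> u" "u \<le> s" for u
          using P[of u] that by (cases "u = s") (auto simp: P_def)
        have cont: "continuous_on {0..s} x" "continuous_on {0..s} v"
          using dom has_vector_derivative_continuous[OF dx] has_vector_derivative_continuous[OF dv]
          by (auto intro!: continuous_at_imp_continuous_on)
        have "\<exists>u\<in>{0<..<s}. norm (x s - x 0) \<le> norm ((s - 0) *\<^sub>R v u)"
          by (rule mvt_general[OF s0 cont(1)])
            (use dom dx in \<open>auto simp: has_vector_derivative_def\<close>)
        then obtain u where u: "0 < u" "u < s" "norm (x s - x 0) \<le> s * norm (v u)" using s0 by auto
        have "s * norm (v u) \<le> T * V"
          using V_bound[of u] u s T by (intro mult_mono) auto
        then have xs: "x s \<in> ball x0 r"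
          using u(3) TV start(2) dist_triangle[of x0 "x s" "x 0"]
          by (simp add: x_def dist_norm norm_minus_commute)
        have "\<exists>u\<in>{0<..<s}. norm (v s - v 0) \<le> norm ((s - 0) *\<^sub>R (- spray (metric_in A g c) (x u) (v u)))"
          by (rule mvt_general[OF s0 cont(2)])
            (use dom dv in \<open>auto simp: has_vector_derivative_def\<close>)
        then obtain u where u: "0 < u" "u < s"
          "norm (v s - v 0) \<le> s * norm (spray (metric_in A g c) (x u) (v u))" using s0 by auto
        have "norm (spray (metric_in A g c) (x u) (v u)) \<le> C * (norm (v u))\<^sup>2"
          using P[of u] u by (intro C(2)) (auto simp: P_def)
        also have "\<dots> \<le> C * V\<^sup>2"
          using V_bound[of u] u C(1) by (intro mult_left_mono power_mono) auto
        finally have "s * norm (spray (metric_in A g c) (x u) (v u)) \<le> T * (C * V\<^sup>2)"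
          using s T by (intro mult_mono) auto
        with u(3) TC have "norm (v s - v 0) \<le> e" by linarith
        with s_dom xs show ?thesis by (simp add: Q_def)
      qed
    qed
    then show "\<gamma> t \<in> chart_dom c \<and> chart_map c (\<gamma> t) \<in> cball x0 r \<and>
      norm (velocity A \<gamma> t c - velocity A \<gamma> 0 c) \<le> e"
      by (auto simp: Q_def x_def v_def)
  qed
qed

lemma isCont_differential:
  assumes "continuously_differentiable A f" "c \<in> A" "x \<in> coords c"
  shows "isCont (\<lambda>y. differential f c y w) x"
proof -
  have "continuous_on (coords c) (\<lambda>y. differential f c y w)"
    using assms(1,2) Ck_on_1D(2) unfolding continuously_differentiable_def differential_def by blast
  then show ?thesis using continuous_on_eq_continuous_at[OF open_coords[OF assms(2)]] assms(3) by blast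
qed

lemma differential_uniformly_close:
  assumes f: "continuously_differentiable A f" and c: "c \<in> A" and x: "x \<in> coords c" and k: "0 < k"
  shows "\<forall>\<^sub>F y in nhds x. \<forall>w. \<bar>differential f c y w - differential f c x w\<bar> \<le> k * norm w"
proof -
  have "\<forall>\<^sub>F y in nhds x. \<bar>differential f c y b - differential f c x b\<bar> < k / DIM('e)" for b
  proof -
    have "isCont (\<lambda>y. \<bar>differential f c y b - differential f c x b\<bar>) x"
      by (intro continuous_intros isCont_differential f c x)
    then show ?thesis
      using k by (intro eventually_nhds_less) auto
  qed
  then have "\<forall>\<^sub>F y in nhds x. \<forall>b\<in>Basis. \<bar>differential f c y b - differential f c x b\<bar> < k / DIM('e)"
    by (intro eventually_ball_finite) auto
  moreover have "\<forall>\<^sub>F y in nhds x. y \<in> coords c"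
    using eventually_nhds_in_open[OF open_coords[OF c] x] .
  ultimately show ?thesis
  proof eventually_elim
    case (elim y)
    have "linear (\<lambda>w. differential f c y w - differential f c x w)"
      by (intro linear_compose_sub linear_differential[OF f c] elim x)
    from abs_linear_le_of_basis[OF this, of "k / DIM('e)"] elim(1)
    show ?case by (auto intro: less_imp_le)
  qed
qed

text \<open>One exponent \<open>j\<close> serves a whole neighbourhood because all constants below depend only on the values at \<open>q\<close> and on
bounds valid in a fixed coordinate ball around it.\<close>

lemma armijo_uniform:
  fixes F :: "'a \<Rightarrow> real^'m"
  assumes F: "continuously_differentiable A F" and complete: "geodesically_complete A g"
    and b: "\<beta> < 1" and q: "\<not> pareto_critical A g F q"
  obtains \<eta> j U where "0 < \<eta>" "open U" "q \<in> U"
    "\<And>p i. p \<in> U \<Longrightarrow> grad_apply A g F p (steepest_descent_direction A g F p) $ i \<le> - \<eta>"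
    "\<And>p. p \<in> U \<Longrightarrow>
      F (riemannian_exp A g p ((1/2)^j *\<^sub>R steepest_descent_direction A g F p))
      \<le> F p + (\<beta> * (1/2)^j) *\<^sub>R grad_apply A g F p (steepest_descent_direction A g F p)"
proof -
  obtain c where c: "c \<in> A" "q \<in> chart_dom c" by (rule obtain_chart)
  interpret coordinate_metric "coords c" "metric_in A g c" by (rule coordinate_metric_chart[OF c(1)])
  define x0 where "x0 = chart_map c q"
  have x0: "x0 \<in> coords c" using c by (simp add: x0_def)
  define G where "G = metric_in A g c"
  define L where "L i = differential (\<lambda>q. F q $ i) c" for i
  note Fi = continuously_differentiable_component[OF F]
  have linear_L: "linear (L i x)" if "x \<in> coords c" for i x
    unfolding L_def by (rule linear_differential[OF Fi c(1) that])

  \<comment> \<open>A common descent vector \<open>u0\<close>, shortened by \<open>s\<close> until the linear term dominates the quadratic one, makes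
      the objective negative; at \<open>s = \<mu> / (G x0 u0 u0 + 1)\<close> it is at most \<open>- s \<mu> / 2 = - 2 \<eta>\<close>.\<close>
  obtain u0 where u0: "\<And>i. L i x0 u0 < 0"
    using q not_pareto_critical_iff[OF F c] by (auto simp: L_def x0_def)
  define \<mu> where "\<mu> = - (MAX i. L i x0 u0)"
  have \<mu>: "0 < \<mu>" using u0 by (simp add: \<mu>_def)
  have \<mu>_le: "L i x0 u0 \<le> - \<mu>" for i
    unfolding \<mu>_def minus_minus by (rule Max_ge) auto
  define s where "s = \<mu> / (G x0 u0 u0 + 1)"
  have G0: "0 \<le> G x w w" if "x \<in> coords c" for x w
    using pos[OF that, of w] G_left(4)[OF that] by (cases "w = 0") (auto simp: G_def)
  have s: "0 < s" using \<mu> G0[OF x0, of u0] by (simp add: s_def)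
  have sG: "s * G x0 u0 u0 \<le> \<mu>"
    using \<mu> G0[OF x0, of u0] by (simp add: s_def field_simps)
  define u where "u = s *\<^sub>R u0"
  define \<eta> where "\<eta> = s * \<mu> / 4"
  have \<eta>: "0 < \<eta>" using s \<mu> by (simp add: \<eta>_def)
  have u: "L i x0 u + G x0 u u / 2 < - \<eta>" for i
  proof -
    have "L i x0 u + G x0 u u / 2 = s * (L i x0 u0 + s * G x0 u0 u0 / 2)"
      by (simp add: u_def G_def G_left[OF x0] G_right[OF x0] linear_scale[OF linear_L[OF x0]] algebra_simps)
    also have "\<dots> \<le> s * (- \<mu> / 2)"
      using s \<mu>_le[of i] sG by (intro mult_left_mono) auto
    also have "\<dots> < - \<eta>" using s \<mu> by (simp add: \<eta>_def)
    finally show ?thesis .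
  qed

  obtain r0 where r0: "0 < r0" "cball x0 r0 \<subseteq> coords c"
    using open_coords[OF c(1)] x0 open_contains_cball by blast
  obtain l where l: "0 < l" "\<And>x w. x \<in> cball x0 r0 \<Longrightarrow> l * (norm w)\<^sup>2 \<le> G x w w"
    using coercive[OF r0(2)] unfolding G_def by blast
  have "\<exists>B>0. \<forall>w. \<bar>L i x0 w\<bar> \<le> B * norm w" for i
    using linear_bounded_pos[OF linear_L[OF x0, of i]] by (metis real_norm_def)
  then obtain B' where B': "\<And>i. 0 < B' i" "\<And>i w. \<bar>L i x0 w\<bar> \<le> B' i * norm w" by metis
  define B where "B = (\<Sum>i\<in>UNIV. B' i)"
  have B'_le: "B' i \<le> B" for i
    unfolding B_def by (rule member_le_sum) (auto intro: less_imp_le B')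
  have B: "0 < B" using less_le_trans[OF B'(1) B'_le] .
  have LB: "\<bar>L i x0 w\<bar> \<le> B * norm w" for i w
    using B'(2)[of i w] mult_right_mono[OF B'_le[of i], of "norm w"] by simp

  \<comment> \<open>\<open>R\<close> will bound the coordinates of \<open>v(p)\<close>, and the Armijo test tolerates a growth of the slope by \<open>\<epsilon>\<close>, which is split into
      three parts: the change of \<open>L\<close> between \<open>x0\<close> and the point on the geodesic, the change of the velocity, and
      the change of \<open>L\<close> between \<open>x0\<close> and the starting point.\<close>
  define R where "R = 2 * (B + 1) / l"
  have R: "0 < R" using B l by (simp add: R_def)
  define \<epsilon> where "\<epsilon> = (1 - \<beta>) * \<eta>"
  have \<epsilon>: "0 < \<epsilon>" using b \<eta> by (simp add: \<epsilon>_def)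
  define e where "e = \<epsilon> / (3 * B)"
  have e: "0 < e" "B * e = \<epsilon> / 3" using \<epsilon> B by (simp_all add: e_def)
  define k where "k = min 1 (\<epsilon> / 3 / (R + e))"
  have k: "0 < k" "k \<le> 1" using \<epsilon> R e by (simp_all add: k_def)
  have kR: "k * (R + e) \<le> \<epsilon> / 3"
    using R e by (subst pos_le_divide_eq[symmetric]) (auto simp: k_def)

  have "\<forall>\<^sub>F x in nhds x0. L i x u + G x u u / 2 < - \<eta>" for i
  proof -
    have "isCont (\<lambda>x. L i x u) x0"
      unfolding L_def by (rule isCont_differential[OF Fi c(1) x0])
    then have "isCont (\<lambda>x. L i x u + G x u u / 2) x0"
      using continuous_at_G[OF x0] unfolding G_def by (intro continuous_intros) auto
    then show ?thesis
      using u[of i] by (rule eventually_nhds_less)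
  qed
  then have "\<forall>\<^sub>F x in nhds x0. \<forall>i. L i x u + G x u u / 2 < - \<eta>" by (rule eventually_all_finite)
  moreover have "\<forall>\<^sub>F x in nhds x0. \<forall>i w. \<bar>L i x w - L i x0 w\<bar> \<le> k * norm w"
    unfolding L_def
    by (intro eventually_all_finite differential_uniformly_close Fi c(1) x0 k)
  moreover have "\<forall>\<^sub>F x in nhds x0. x \<in> ball x0 r0"
    using r0(1) by (intro eventually_nhds_in_open) auto
  ultimately have "\<forall>\<^sub>F x in nhds x0. (\<forall>i. L i x u + G x u u / 2 < - \<eta>) \<and>
      (\<forall>i w. \<bar>L i x w - L i x0 w\<bar> \<le> k * norm w) \<and> x \<in> ball x0 r0"
    by (intro eventually_conj)
  then obtain r1 where r1: "0 < r1" "\<And>x. dist x x0 < r1 \<Longrightarrow> (\<forall>i. L i x u + G x u u / 2 < - \<eta>) \<and>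
      (\<forall>i w. \<bar>L i x w - L i x0 w\<bar> \<le> k * norm w) \<and> x \<in> ball x0 r0"
    by (auto simp: eventually_nhds_metric)
  define r where "r = r1 / 2"
  have r: "0 < r" using r1 by (simp add: r_def)
  have near: "L i x u + G x u u / 2 < - \<eta>" "\<bar>L i x w - L i x0 w\<bar> \<le> k * norm w" "x \<in> cball x0 r0"
    "x \<in> coords c" if "x \<in> cball x0 r" for x i w
  proof -
    have "dist x x0 < r1" using that r by (simp add: r_def dist_commute)
    from r1(2)[OF this] r0(2) show "L i x u + G x u u / 2 < - \<eta>" "\<bar>L i x w - L i x0 w\<bar> \<le> k * norm w"
      "x \<in> cball x0 r0" "x \<in> coords c" by auto
  qed
  have sub: "cball x0 r \<subseteq> coords c" using near(4) by blast
  obtain T where T: "0 < T"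
    "\<And>\<gamma> t. geodesic A g \<gamma> \<Longrightarrow> \<gamma> 0 \<in> chart_dom c \<Longrightarrow> chart_map c (\<gamma> 0) \<in> cball x0 (r / 2) \<Longrightarrow>
      norm (velocity A \<gamma> 0 c) \<le> R \<Longrightarrow> 0 \<le> t \<Longrightarrow> t \<le> T \<Longrightarrow>
      \<gamma> t \<in> chart_dom c \<and> chart_map c (\<gamma> t) \<in> cball x0 r \<and>
      norm (velocity A \<gamma> t c - velocity A \<gamma> 0 c) \<le> e"
    using geodesic_stays_near[OF c(1) sub r less_imp_le[OF R] e(1)] by blast
  obtain j where j: "(1/2 :: real) ^ j < T" using real_arch_pow_inv[of T "1/2"] T(1) by auto
  define t where "t = (1/2 :: real) ^ j"
  have t: "0 < t" "t \<le> T" using j by (auto simp: t_def)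

  define U where "U = chart_dom c \<inter> chart_map c -` ball x0 (r / 2)"
  have "open U"
    unfolding U_def
    by (rule continuous_open_preimage[OF continuous_on_chart_map[OF c(1)] open_chart_dom[OF c(1)]]) simp
  moreover have "q \<in> U" using c r by (simp add: U_def x0_def)
  moreover have "(\<forall>i. grad_apply A g F p (steepest_descent_direction A g F p) $ i \<le> - \<eta>) \<and>
      F (riemannian_exp A g p (t *\<^sub>R steepest_descent_direction A g F p))
      \<le> F p + (\<beta> * t) *\<^sub>R grad_apply A g F p (steepest_descent_direction A g F p)" if p: "p \<in> U" for p
  proof -
    have pc: "p \<in> chart_dom c" "chart_map c p \<in> cball x0 (r / 2)" using p by (auto simp: U_def)
    define x where "x = chart_map c p"
    have x: "x \<in> cball x0 r" using pc r unfolding x_def by auto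
    note xS = near(4)[OF x]
    define v where "v = steepest_descent_direction A g F p"
    have v: "v \<in> tangent_space A p"
      unfolding v_def by (rule steepest_descent_direction(1)[OF F c(1) pc(1)])
    define w where "w = v c"
    have grad: "grad_apply A g F p v $ i = L i x w" for i
      using grad_apply_component[OF F v c(1) pc(1)] by (simp add: L_def x_def w_def)
    have "(MAX i. L i x w) + G x w w / 2 \<le> (MAX i. L i x u) + G x u u / 2"
      using steepest_descent_direction(2)[OF F c(1) pc(1), of u]
      by (simp add: L_def x_def w_def v_def G_def)
    also have "(MAX i. L i x u) \<le> - \<eta> - G x u u / 2"
      using near(1)[OF x] by (intro Max.boundedI) (auto intro!: less_imp_le simp: field_simps)
    finally have max: "(MAX i. L i x w) + G x w w / 2 \<le> - \<eta>" by simp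
    have Lw: "L i x w + G x w w / 2 \<le> - \<eta>" for i
      by (rule order_trans[OF add_right_mono[OF Max_ge] max]) auto
    have descent: "L i x w \<le> - \<eta>" for i using Lw[of i] G0[OF xS, of w] by simp
    \<comment> \<open>The objective is negative at \<open>w\<close>, so the quadratic term is at most the absolute value of the linear one.\<close>
    have w: "norm w \<le> R"
    proof -
      obtain i :: 'm where True by simp
      have "l * (norm w)\<^sup>2 \<le> G x w w" using l(2)[OF near(3)[OF x]] .
      moreover have "\<bar>L i x w\<bar> \<le> (B + 1) * norm w"
        using near(2)[OF x, of i w] LB[of i w] mult_right_mono[OF k(2), of "norm w"]
        by (simp add: algebra_simps)
      ultimately have "l * (norm w)\<^sup>2 / 2 \<le> (B + 1) * norm w" using Lw[of i] \<eta> by simp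
      then have "l * norm w * norm w \<le> 2 * (B + 1) * norm w" by (simp add: power2_eq_square mult_ac)
      then have "l * norm w \<le> 2 * (B + 1)"
        using B by (cases "w = 0") auto
      then show ?thesis using l(1) by (simp add: R_def field_simps)
    qed
    obtain \<gamma> where \<gamma>: "geodesic A g \<gamma>" "\<gamma> 0 = p" "velocity A \<gamma> 0 = v"
      using complete v unfolding geodesically_complete_def by blast
    have exp: "riemannian_exp A g p (t *\<^sub>R v) = \<gamma> t"
      using riemannian_exp_geodesic[OF \<gamma>(1), of t] \<gamma>(2,3) by simp
    have short: "\<gamma> \<tau> \<in> chart_dom c \<and> chart_map c (\<gamma> \<tau>) \<in> cball x0 r \<and> norm (velocity A \<gamma> \<tau> c - w) \<le> e"
      if "0 \<le> \<tau>" "\<tau> \<le> t" for \<tau>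
      using T(2)[OF \<gamma>(1), of \<tau>] pc \<gamma>(2,3) w t that by (simp add: w_def)
    have "F (\<gamma> t) $ i \<le> F p $ i + \<beta> * t * L i x w" for i
    proof -
      define h where "h \<tau> = F (\<gamma> \<tau>) $ i" for \<tau>
      have dh: "(h has_real_derivative L i (chart_map c (\<gamma> \<tau>)) (velocity A \<gamma> \<tau> c)) (at \<tau>)"
        if "0 \<le> \<tau>" "\<tau> \<le> t" for \<tau>
      proof -
        have dom: "\<gamma> \<tau> \<in> chart_dom c" using short[OF that] by simp
        let ?f = "(\<lambda>q. F q $ i) \<circ> chart_inv c"
        have "(?f has_derivative L i (chart_map c (\<gamma> \<tau>))) (at ((chart_map c \<circ> \<gamma>) \<tau>))"
          using has_derivative_differential[OF Fi c(1), of "chart_map c (\<gamma> \<tau>)"] dom by (simp add: L_def)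
        from diff_chain_at[OF geodesic_in_chart(1)[OF \<gamma>(1) c(1) dom, unfolded has_vector_derivative_def] this]
        have "(?f \<circ> (chart_map c \<circ> \<gamma>) has_derivative
            (\<lambda>y. y * L i (chart_map c (\<gamma> \<tau>)) (velocity A \<gamma> \<tau> c))) (at \<tau>)"
          using linear_scale[OF linear_L, of "chart_map c (\<gamma> \<tau>)"] dom by (simp add: comp_def)
        moreover have "open (\<gamma> -` chart_dom c)"
          by (rule open_vimage[OF open_chart_dom[OF c(1)] geodesic_continuous_on[OF \<gamma>(1)]])
        ultimately have "(h has_derivative
            (\<lambda>y. y * L i (chart_map c (\<gamma> \<tau>)) (velocity A \<gamma> \<tau> c))) (at \<tau>)"
          by (rule has_derivative_transform_within_open)
            (use dom in \<open>auto simp: h_def chart_inv_map[OF c(1)]\<close>)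
        then show ?thesis
          by (simp add: has_field_derivative_def mult.commute[of _ "L i (chart_map c (\<gamma> \<tau>)) (velocity A \<gamma> \<tau> c)"])
      qed
      obtain \<tau> where \<tau>: "0 < \<tau>" "\<tau> < t"
        "h t - h 0 = (t - 0) * L i (chart_map c (\<gamma> \<tau>)) (velocity A \<gamma> \<tau> c)"
        using MVT2[OF t(1), of h "\<lambda>\<tau>. L i (chart_map c (\<gamma> \<tau>)) (velocity A \<gamma> \<tau> c)"] dh by auto
      define y where "y = chart_map c (\<gamma> \<tau>)"
      define w' where "w' = velocity A \<gamma> \<tau> c"
      have y: "y \<in> cball x0 r" and w': "norm (w' - w) \<le> e"
        using short[of \<tau>] \<tau> by (auto simp: y_def w'_def)
      have "norm w' \<le> R + e" using w w' norm_triangle_sub[of w' w] by linarith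
      then have "k * norm w' \<le> \<epsilon> / 3"
        using k(1) by (intro order_trans[OF mult_left_mono kR]) auto
      then have 1: "\<bar>L i y w' - L i x0 w'\<bar> \<le> \<epsilon> / 3" using near(2)[OF y, of i w'] by linarith
      have 2: "\<bar>L i x0 w' - L i x0 w\<bar> \<le> \<epsilon> / 3"
        using LB[of i "w' - w"] mult_left_mono[OF w', of B] B e(2)
        by (simp add: linear_diff[OF linear_L[OF x0]])
      have "k * norm w \<le> \<epsilon> / 3"
        using k(1) w e(1) by (intro order_trans[OF mult_left_mono kR]) auto
      then have 3: "\<bar>L i x w - L i x0 w\<bar> \<le> \<epsilon> / 3" using near(2)[OF x, of i w] by linarith
      have "L i y w' \<le> L i x w + \<epsilon>" using 1 2 3 by linarith
      \<comment> \<open>Here \<open>\<epsilon> = (1 - \<beta>) \<eta>\<close> is absorbed by \<open>(1 - \<beta>) L i x w \<le> - (1 - \<beta>) \<eta>\<close>.\<close>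
      also have "\<dots> \<le> \<beta> * L i x w"
        using mult_left_mono[OF descent[of i], of "1 - \<beta>"] b by (simp add: \<epsilon>_def algebra_simps)
      finally have "t * L i y w' \<le> t * (\<beta> * L i x w)" using t(1) by (simp add: mult_left_mono)
      then show ?thesis using \<tau>(3) \<gamma>(2) by (simp add: h_def y_def w'_def mult_ac)
    qed
    then have "F (riemannian_exp A g p (t *\<^sub>R v)) \<le> F p + (\<beta> * t) *\<^sub>R grad_apply A g F p v"
      unfolding exp less_eq_vec_def by (simp add: grad)
    then show ?thesis using descent by (simp add: grad v_def[symmetric])
  qed
  ultimately show ?thesis using that[of \<eta> U j] \<eta> unfolding t_def by blast
qed

end

section \<open>Convergence of the method\<close>

text \<open>The greatest admissible step belongs to the least admissible exponent; it exists as soon as one exponent is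
admissible, and is at least as large as the corresponding step.\<close>

lemma armijo_step:
  assumes "F (riemannian_exp A g p ((1/2)^j *\<^sub>R v)) \<le> F p + (\<beta> * (1/2)^j) *\<^sub>R grad_apply A g F p v"
  shows armijo_step_ge: "(1/2)^j \<le> armijo_step A g F \<beta> p v"
    and armijo_step_admissible: "F (riemannian_exp A g p (armijo_step A g F \<beta> p v *\<^sub>R v))
      \<le> F p + (\<beta> * armijo_step A g F \<beta> p v) *\<^sub>R grad_apply A g F p v"
proof -
  define P where "P j \<longleftrightarrow> F (riemannian_exp A g p ((1/2)^j *\<^sub>R v))
      \<le> F p + (\<beta> * (1/2)^j) *\<^sub>R grad_apply A g F p v" for j :: nat
  have Pj: "P j" using assms by (simp add: P_def)
  define k where "k = (LEAST j. P j)"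
  have "P k" unfolding k_def using Pj by (rule LeastI)
  have least: "k \<le> i" if "P i" for i unfolding k_def using that by (rule Least_le)
  have "armijo_step A g F \<beta> p v = (1/2)^k"
    unfolding armijo_step_def
  proof (rule Greatest_equality)
    show "\<exists>j. (1/2 :: real)^k = (1/2)^j \<and>
      F (riemannian_exp A g p ((1/2)^k *\<^sub>R v)) \<le> F p + (\<beta> * (1/2)^k) *\<^sub>R grad_apply A g F p v"
      using \<open>P k\<close> unfolding P_def by blast
    fix t assume "\<exists>j. t = (1/2 :: real)^j \<and>
      F (riemannian_exp A g p (t *\<^sub>R v)) \<le> F p + (\<beta> * t) *\<^sub>R grad_apply A g F p v"
    then obtain i where "t = (1/2)^i" "P i" unfolding P_def by blast
    then show "t \<le> (1/2)^k" using least[of i] by (simp add: power_decreasing)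
  qed
  then show "(1/2)^j \<le> armijo_step A g F \<beta> p v"
    and "F (riemannian_exp A g p (armijo_step A g F \<beta> p v *\<^sub>R v))
      \<le> F p + (\<beta> * armijo_step A g F \<beta> p v) *\<^sub>R grad_apply A g F p v"
    using \<open>P k\<close> least[OF Pj] by (auto simp: P_def power_decreasing)
qed

theorem theorem10:
  fixes A :: "('a::{t2_space, second_countable_topology}, 'e::euclidean_space) chart set"
    and g :: "('a, 'e) metric"
    and F :: "'a \<Rightarrow> real^'m"
    and \<beta> :: real
    and p :: "nat \<Rightarrow> 'a"
  assumes "smooth_atlas A"
    and "riemannian_metric A g"
    and "connected (UNIV :: 'a set)"
    and "geodesically_complete A g"
    and "continuously_differentiable A F"
    and "0 < \<beta>" and "\<beta> < 1"
    and "steepest_descent_sequence A g F \<beta> p"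
  shows "(\<forall>k. \<forall>i. F (p (Suc k)) $ i < F (p k) $ i) \<and>
         (\<forall>q. accumulation_point p q \<longrightarrow> pareto_critical A g F q)"
proof -
  interpret riemannian_manifold A g by (rule riemannian_manifold.intro[OF assms(1,2)])
  define v where "v k = steepest_descent_direction A g F (p k)" for k
  have noncritical: "\<not> pareto_critical A g F (p k)"
    and step: "p (Suc k) = riemannian_exp A g (p k) (armijo_step A g F \<beta> (p k) (v k) *\<^sub>R v k)" for k
    using assms(8) unfolding steepest_descent_sequence_def Let_def v_def by blast+
  \<comment> \<open>The constant \<open>\<delta>\<close> is the same for all iterates in \<open>U\<close>; this uniformity is used at accumulation points.\<close>
  have decrease: "\<exists>\<delta>>0. \<exists>U. open U \<and> q \<in> U \<and> (\<forall>k i. p k \<in> U \<longrightarrow> F (p (Suc k)) $ i \<le> F (p k) $ i - \<delta>)"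
    if q: "\<not> pareto_critical A g F q" for q
  proof -
    obtain \<eta> j U where U: "0 < \<eta>" "open U" "q \<in> U"
      and descent: "\<And>p i. p \<in> U \<Longrightarrow> grad_apply A g F p (steepest_descent_direction A g F p) $ i \<le> - \<eta>"
      and armijo: "\<And>p. p \<in> U \<Longrightarrow>
        F (riemannian_exp A g p ((1/2)^j *\<^sub>R steepest_descent_direction A g F p))
        \<le> F p + (\<beta> * (1/2)^j) *\<^sub>R grad_apply A g F p (steepest_descent_direction A g F p)"
      using armijo_uniform[OF assms(5,4,7) q] by metis
    have "F (p (Suc k)) $ i \<le> F (p k) $ i - \<beta> * (1/2)^j * \<eta>" if k: "p k \<in> U" for k i
    proof -
      define t where "t = armijo_step A g F \<beta> (p k) (v k)"
      note ge = armijo_step[of F A g "p k" j "v k" \<beta>, folded t_def, OF armijo[OF k, folded v_def]]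
      have "F (p (Suc k)) $ i \<le> F (p k) $ i + \<beta> * t * grad_apply A g F (p k) (v k) $ i"
        using ge(2) unfolding step[of k] t_def[symmetric] less_eq_vec_def by simp
      also have "\<beta> * t * grad_apply A g F (p k) (v k) $ i \<le> \<beta> * t * - \<eta>"
        using descent[OF k, of i, folded v_def] assms(6) ge(1)
        by (intro mult_left_mono mult_nonneg_nonneg) (auto intro: order_trans[rotated])
      also have "\<beta> * t * - \<eta> \<le> - (\<beta> * (1/2)^j * \<eta>)"
        using ge(1) assms(6) U(1) by (simp add: mult_right_mono)
      finally show ?thesis by simp
    qed
    moreover have "0 < \<beta> * (1/2)^j * \<eta>" using assms(6) U(1) by simp
    ultimately show ?thesis using U(2,3) by blast
  qed
  have decr: "F (p (Suc k)) $ i < F (p k) $ i" for k i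
  proof -
    obtain \<delta> U where "\<delta> > 0" "p k \<in> U" "\<forall>k i. p k \<in> U \<longrightarrow> F (p (Suc k)) $ i \<le> F (p k) $ i - \<delta>"
      using decrease[OF noncritical] by metis
    then have "F (p (Suc k)) $ i \<le> F (p k) $ i - \<delta>" by blast
    with \<open>\<delta> > 0\<close> show ?thesis by simp
  qed
  have "pareto_critical A g F q" if acc: "accumulation_point p q" for q
  proof (rule ccontr)
    assume q: "\<not> pareto_critical A g F q"
    obtain r where r: "strict_mono r" "(p \<circ> r) \<longlonglongrightarrow> q"
      using acc unfolding accumulation_point_def by blast
    obtain \<delta> U where U: "\<delta> > 0" "open U" "q \<in> U"
      "\<And>k i. p k \<in> U \<Longrightarrow> F (p (Suc k)) $ i \<le> F (p k) $ i - \<delta>"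
      using decrease[OF q] by metis
    obtain i :: 'm where True by simp
    \<comment> \<open>One component of \<open>F\<close> already yields the contradiction.\<close>
    have anti: "F (p m) $ i \<le> F (p n) $ i" if "n \<le> m" for m n
      using that by (induction rule: dec_induct) (auto intro: order_trans less_imp_le[OF decr])
    have lim: "(\<lambda>n. F (p (r n)) $ i) \<longlonglongrightarrow> F q $ i"
      using isCont_tendsto_compose[OF isCont_continuously_differentiable
          [OF continuously_differentiable_component[OF assms(5)]] r(2)] by (simp add: comp_def)
    have "\<forall>\<^sub>F n in sequentially. F (p (r (Suc n))) $ i \<le> F (p (r n)) $ i - \<delta>"
      using topological_tendstoD[OF r(2) U(2,3)]
    proof eventually_elim
      case (elim n)
      have "Suc (r n) \<le> r (Suc n)" using strict_monoD[OF r(1), of n "Suc n"] by simp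
      from anti[OF this] U(4)[of "r n" i] elim show ?case by simp
    qed
    then have "F q $ i \<le> F q $ i - \<delta>"
      by (rule tendsto_le[OF sequentially_bot tendsto_diff[OF lim tendsto_const] LIMSEQ_Suc[OF lim]])
    with U(1) show False by simp
  qed
  with decr show ?thesis by blast
qed

end
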